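(* Let $k \ge 1$ and let $(\Lambda, d)$ be a compactly aligned topological $k$-graph with no sources. Then the following conditions are equivalent. (A) For every nonempty open set $V \subset \Lambda^0$ there exists an aperiodic path $x \in V\partial\Lambda$. (B) For every nonempty open set $V \subset \Lambda^0$ and every pair $m \neq n \in \mathbb{N}^k$ there exists a path $\lambda = \lambda_{V,m,n} \in V\Lambda$ such that $d(\lambda) \geq m \vee n$ and $$\lambda(m,\, m + d(\lambda) - (m \vee n)) \neq \lambda(n,\, n + d(\lambda) - (m \vee n)).$$ (C) For every pair of distinct open sets $X, Y \subset \Lambda$ such that $s(X) = s(Y)$ and both $s|_X$ and $s|_Y$ are homeomorphisms (onto their image), there exists $\tau \in s(X)\Lambda$ such that $\operatorname{MCE}(X\tau, Y\tau) = \emptyset$.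
   Context: $\mathbb{N}$ contains $0$; $\mathbb{N}^k$ is regarded as a category with one object and composition given by addition. For $m,n\in\mathbb{N}^k$, $m \ge n$ means $m_i\ge n_i$ for all $i$; $m\vee n$ and $m \wedge n$ denote the coordinatewise maximum and minimum. A topological $k$-graph is a pair $(\Lambda,d)$ consisting of a small category $\Lambda = (\mathrm{Obj}(\Lambda),\mathrm{Mor}(\Lambda), r,s)$ and a functor $d:\Lambda\to\mathbb{N}^k$ (the degree map) such that: (1) $\mathrm{Obj}(\Lambda)$ and $\mathrm{Mor}(\Lambda)$ are second-countable, locally compact, Hausdorff spaces; (2) the range and source maps $r,s:\mathrm{Mor}(\Lambda)\to\mathrm{Obj}(\Lambda)$ are continuous and $s$ is a local homeomorphism; (3) composition $\circ:\Lambda\times_c\Lambda\to\Lambda$ is continuous and open, where $\Lambda\times_c\Lambda$ is the set of composable pairs $(\lambda,\mu)$, $s(\lambda)=r(\mu)$, with the relative topology from the product topology; (4) $d$ is continuous, where $\mathbb{N}^k$ is discrete; (5) (unique factorization) for all $\lambda\in\Lambda$ and $m,n\in\mathbb{N}^k$ with $d(\lambda)=m+n$ there exist unique $\mu,\nu\in\Lambda$ with $d(\mu)=m$, $d(\nu)=n$ and $\lambda=\mu\nu$. Elements of $\Lambda$ (i.e. of $\mathrm{Mor}(\Lambda)$) are called paths. $\Lambda^n := d^{-1}(n)$. $\Lambda^0$ is the set of identity morphisms, called vertices and identified with $\mathrm{Obj}(\Lambda)$. For $X,Y\subset\Lambda$, $XY := \{\mu\nu : \mu\in X,\nu\in Y,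 s(\mu)=r(\nu)\}$; for single elements write $X\tau = X\{\tau\}$, $v\Lambda=\{v\}\Lambda$. In particular, for $V\subset\Lambda^0$, $V\Lambda=\{\lambda\in\Lambda : r(\lambda)\in V\}$. A vertex $v$ is a source if $v\Lambda^n=\emptyset$ for some $n\in\mathbb{N}^k$; $\Lambda$ has no sources if no vertex is a source. For $p\le q\le d(\lambda)$, $\lambda(p,q)$ denotes the unique element of $\Lambda^{q-p}$ such that $\lambda=\lambda'\,\lambda(p,q)\,\lambda''$ with $d(\lambda')=p$ and $d(\lambda'')=d(\lambda)-q$. For paths $\mu,\nu\in\Lambda$, $\operatorname{MCE}(\mu,\nu)$ is the set of minimal common extensions: those $\lambda\in\Lambda$ with $\lambda=\mu\mu'=\nu\nu'$ for some $\mu',\nu'\in\Lambda$ and $d(\lambda)=d(\mu)\vee d(\nu)$. For $X,Y\subset\Lambda$, $\operatorname{MCE}(X,Y):=\bigcup_{\mu\in X,\nu\in Y}\operatorname{MCE}(\mu,\nu)$. $\Lambda$ is compactly aligned if $\operatorname{MCE}(X,Y)$ is compact whenever $X,Y\subset\Lambda$ are compact. For $m\in(\mathbb{N}\cup\{\infty\})^k$, $\Omega_{k,m}$ is the discrete $k$-graph with morphisms $\{(p,q)\in\mathbb{N}^k\times\mathbb{N}^k : p\le q\le m\}$, $r(p,q)=(p,p)$, $s(p,q)=(q,q)$, $(p,q)(q,t)=(p,t)$ and degree $q-p$. The path space $X_\Lambda$ is the set of all continuous degree-preserving functors $x:\Omega_{k,m}\to\Lambda$, $m\in(\mathbb{N}\cup\{\infty\})^k$;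 for such $x$ set $d(x)=m$ and $r(x)=x(0,0)$. For $m\in\mathbb{N}^k$ with $m\le d(x)$, the shift $\sigma^m x\in X_\Lambda$ is the unique path with $d(\sigma^m x)=d(x)-m$ and $\sigma^m x(0,n)=x(m,m+n)$ for all $0\le n\le d(x)-m$. A path $x\in X_\Lambda$ is aperiodic if for any $m,n\in\mathbb{N}^k$ (for which the shifts are defined), $\sigma^m x=\sigma^n x$ implies $m=n$. For $v\in\Lambda^0$, a subset $E\subset\Lambda$ is compact exhaustive for $v$ if $E$ is compact, $r(E)$ is a neighborhood of $v$, and for all $\lambda\in r(E)\Lambda$ there is $\mu\in E$ with $\operatorname{MCE}(\lambda,\mu)\ne\emptyset$. A path $x\in X_\Lambda$ is a boundary path if for every $m\in\mathbb{N}^k$ with $m\le d(x)$ and every $E$ that is compact exhaustive for $x(m,m)$, there exists $\lambda\in E$ such that $x(m,m+d(\lambda))=\lambda$ (in particular $m+d(\lambda)\le d(x)$). $\partial\Lambda$ is the set of boundary paths, and $V\partial\Lambda=\{x\in\partial\Lambda : r(x)\in V\}$. *)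

theory Defs
  imports "HOL-Analysis.Analysis"
begin

text \<open>
  A point of \<open>\<nat>\<^sup>k\<close> has type \<^typ>\<open>nat ^ 'k\<close> and a point of \<open>(\<nat> \<union> {\<infinity>})\<^sup>k\<close> has type
  \<^typ>\<open>enat ^ 'k\<close>, where \<open>k = CARD('k) \<ge> 1\<close>. The order, sum and difference of the library
  on these types are coordinatewise.
\<close>

definition vjoin :: "nat ^ 'k \<Rightarrow> nat ^ 'k \<Rightarrow> nat ^ 'k" (infixl \<open>\<squnion>\<^sub>v\<close> 65) where
  "m \<squnion>\<^sub>v n = (\<chi> i. max (m $ i) (n $ i))"

definition to_enat :: "nat ^ 'k \<Rightarrow> enat ^ 'k" where
  "to_enat m = (\<chi> i. enat (m $ i))"

lemma vjoin_nth [simp]: "(m \<squnion>\<^sub>v n) $ i = max (m $ i) (n $ i)"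
  by (simp add: vjoin_def)

lemma to_enat_nth [simp]: "to_enat m $ i = enat (m $ i)"
  by (simp add: to_enat_def)


section \<open>Topological preliminaries\<close>

definition second_countable :: "'a topology \<Rightarrow> bool" where
  "second_countable X \<longleftrightarrow>
     (\<exists>\<B>. countable \<B> \<and> (\<forall>B\<in>\<B>. openin X B) \<and>
          (\<forall>U x. openin X U \<and> x \<in> U \<longrightarrow> (\<exists>B\<in>\<B>. x \<in> B \<and> B \<subseteq> U)))"

definition local_homeomorphism :: "'a topology \<Rightarrow> 'b topology \<Rightarrow> ('a \<Rightarrow> 'b) \<Rightarrow> bool" where
  "local_homeomorphism X Y f \<longleftrightarrow>
     f \<in> topspace X \<rightarrow> topspace Y \<and>
     (\<forall>x\<in>topspace X. \<exists>U. openin X U \<and> x \<in> U \<and> openin Y (f ` U) \<and>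
        homeomorphic_map (subtopology X U) (subtopology Y (f ` U)) f)"


section \<open>Topological higher-rank graphs\<close>

text \<open>
  The object space and the morphism space are kept apart; \<open>idt\<close> sends an object to its
  identity morphism. Thus a vertex is represented by an object, and open subsets of
  \<open>\<Lambda>\<^sup>0\<close> by open subsets of the object space.
\<close>

record ('v, 'a, 'k) kgraph =
  otop :: "'v topology"
  mtop :: "'a topology"
  rng :: "'a \<Rightarrow> 'v"
  src :: "'a \<Rightarrow> 'v"
  idt :: "'v \<Rightarrow> 'a"
  cmp :: "'a \<Rightarrow> 'a \<Rightarrow> 'a"
  deg :: "'a \<Rightarrow> nat ^ 'k"

abbreviation Obj :: "('v, 'a, 'k::finite) kgraph \<Rightarrow> 'v set" where
  "Obj \<Lambda> \<equiv> topspace (otop \<Lambda>)"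

abbreviation Mor :: "('v, 'a, 'k::finite) kgraph \<Rightarrow> 'a set" where
  "Mor \<Lambda> \<equiv> topspace (mtop \<Lambda>)"

definition composable :: "('v, 'a, 'k::finite) kgraph \<Rightarrow> ('a \<times> 'a) set" where
  "composable \<Lambda> = {(\<rho>, \<mu>). \<rho> \<in> Mor \<Lambda> \<and> \<mu> \<in> Mor \<Lambda> \<and> src \<Lambda> \<rho> = rng \<Lambda> \<mu>}"

locale small_category =
  fixes \<Lambda> :: "('v, 'a, 'k::finite) kgraph"
  assumes rng_Obj: "\<rho> \<in> Mor \<Lambda> \<Longrightarrow> rng \<Lambda> \<rho> \<in> Obj \<Lambda>"
    and src_Obj: "\<rho> \<in> Mor \<Lambda> \<Longrightarrow> src \<Lambda> \<rho> \<in> Obj \<Lambda>"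
    and idt_Mor: "v \<in> Obj \<Lambda> \<Longrightarrow> idt \<Lambda> v \<in> Mor \<Lambda>"
    and rng_idt: "v \<in> Obj \<Lambda> \<Longrightarrow> rng \<Lambda> (idt \<Lambda> v) = v"
    and src_idt: "v \<in> Obj \<Lambda> \<Longrightarrow> src \<Lambda> (idt \<Lambda> v) = v"
    and cmp_Mor: "(\<rho>, \<mu>) \<in> composable \<Lambda> \<Longrightarrow> cmp \<Lambda> \<rho> \<mu> \<in> Mor \<Lambda>"
    and rng_cmp: "(\<rho>, \<mu>) \<in> composable \<Lambda> \<Longrightarrow> rng \<Lambda> (cmp \<Lambda> \<rho> \<mu>) = rng \<Lambda> \<rho>"
    and src_cmp: "(\<rho>, \<mu>) \<in> composable \<Lambda> \<Longrightarrow> src \<Lambda> (cmp \<Lambda> \<rho> \<mu>) = src \<Lambda> \<mu>"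
    and cmp_assoc: "\<lbrakk>(\<rho>, \<mu>) \<in> composable \<Lambda>; (\<mu>, \<nu>) \<in> composable \<Lambda>\<rbrakk>
      \<Longrightarrow> cmp \<Lambda> (cmp \<Lambda> \<rho> \<mu>) \<nu> = cmp \<Lambda> \<rho> (cmp \<Lambda> \<mu> \<nu>)"
    and idt_cmp: "\<rho> \<in> Mor \<Lambda> \<Longrightarrow> cmp \<Lambda> (idt \<Lambda> (rng \<Lambda> \<rho>)) \<rho> = \<rho>"
    and cmp_idt: "\<rho> \<in> Mor \<Lambda> \<Longrightarrow> cmp \<Lambda> \<rho> (idt \<Lambda> (src \<Lambda> \<rho>)) = \<rho>"

locale topological_kgraph = small_category \<Lambda>
  for \<Lambda> :: "('v, 'a, 'k::finite) kgraph" +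
  assumes deg_idt: "v \<in> Obj \<Lambda> \<Longrightarrow> deg \<Lambda> (idt \<Lambda> v) = 0"
    and deg_cmp: "(\<rho>, \<mu>) \<in> composable \<Lambda> \<Longrightarrow> deg \<Lambda> (cmp \<Lambda> \<rho> \<mu>) = deg \<Lambda> \<rho> + deg \<Lambda> \<mu>"
    and second_countable_otop: "second_countable (otop \<Lambda>)"
    and locally_compact_otop: "locally_compact_space (otop \<Lambda>)"
    and Hausdorff_otop: "Hausdorff_space (otop \<Lambda>)"
    and second_countable_mtop: "second_countable (mtop \<Lambda>)"
    and locally_compact_mtop: "locally_compact_space (mtop \<Lambda>)"
    and Hausdorff_mtop: "Hausdorff_space (mtop \<Lambda>)"
    and continuous_rng: "continuous_map (mtop \<Lambda>) (otop \<Lambda>) (rng \<Lambda>)"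
    and continuous_src: "continuous_map (mtop \<Lambda>) (otop \<Lambda>) (src \<Lambda>)"
    and local_homeomorphism_src: "local_homeomorphism (mtop \<Lambda>) (otop \<Lambda>) (src \<Lambda>)"
    and continuous_cmp:
      "continuous_map (subtopology (prod_topology (mtop \<Lambda>) (mtop \<Lambda>)) (composable \<Lambda>)) (mtop \<Lambda>)
         (\<lambda>(\<rho>, \<mu>). cmp \<Lambda> \<rho> \<mu>)"
    and open_cmp:
      "open_map (subtopology (prod_topology (mtop \<Lambda>) (mtop \<Lambda>)) (composable \<Lambda>)) (mtop \<Lambda>)
         (\<lambda>(\<rho>, \<mu>). cmp \<Lambda> \<rho> \<mu>)"
    and continuous_deg: "continuous_map (mtop \<Lambda>) (discrete_topology UNIV) (deg \<Lambda>)"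
    and unique_factorization: "\<lbrakk>\<rho> \<in> Mor \<Lambda>; deg \<Lambda> \<rho> = m + n\<rbrakk>
      \<Longrightarrow> \<exists>!(\<mu>, \<nu>). (\<mu>, \<nu>) \<in> composable \<Lambda> \<and> deg \<Lambda> \<mu> = m \<and> deg \<Lambda> \<nu> = n \<and> \<rho> = cmp \<Lambda> \<mu> \<nu>"

text \<open>The product \<open>XY\<close> of two sets of paths, and \<open>V\<Lambda>\<close> for a set \<open>V\<close> of vertices.\<close>

definition set_cmp :: "('v, 'a, 'k::finite) kgraph \<Rightarrow> 'a set \<Rightarrow> 'a set \<Rightarrow> 'a set" where
  "set_cmp \<Lambda> X Y = {cmp \<Lambda> \<mu> \<nu> |\<mu> \<nu>. \<mu> \<in> X \<and> \<nu> \<in> Y \<and> src \<Lambda> \<mu> = rng \<Lambda> \<nu>}"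

definition paths_into :: "('v, 'a, 'k::finite) kgraph \<Rightarrow> 'v set \<Rightarrow> 'a set" where
  "paths_into \<Lambda> V = {\<rho> \<in> Mor \<Lambda>. rng \<Lambda> \<rho> \<in> V}"

definition is_source :: "('v, 'a, 'k::finite) kgraph \<Rightarrow> 'v \<Rightarrow> bool" where
  "is_source \<Lambda> v \<longleftrightarrow> (\<exists>n. {\<rho> \<in> paths_into \<Lambda> {v}. deg \<Lambda> \<rho> = n} = {})"

definition no_sources :: "('v, 'a, 'k::finite) kgraph \<Rightarrow> bool" where
  "no_sources \<Lambda> \<longleftrightarrow> (\<forall>v\<in>Obj \<Lambda>. \<not> is_source \<Lambda> v)"

text \<open>The segment \<open>\<rho>(p,q)\<close>, for \<open>p \<le> q \<le> d(\<rho>)\<close>; it is well defined by \<open>segment_ex1\<close> below.\<close>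

definition segment :: "('v, 'a, 'k::finite) kgraph \<Rightarrow> 'a \<Rightarrow> nat ^ 'k \<Rightarrow> nat ^ 'k \<Rightarrow> 'a" where
  "segment \<Lambda> \<rho> p q = (THE \<mu>. \<mu> \<in> Mor \<Lambda> \<and> deg \<Lambda> \<mu> = q - p \<and>
     (\<exists>\<rho>' \<rho>''. (\<rho>', \<mu>) \<in> composable \<Lambda> \<and> (\<mu>, \<rho>'') \<in> composable \<Lambda> \<and>
        deg \<Lambda> \<rho>' = p \<and> deg \<Lambda> \<rho>'' = deg \<Lambda> \<rho> - q \<and> \<rho> = cmp \<Lambda> (cmp \<Lambda> \<rho>' \<mu>) \<rho>''))"

definition mce :: "('v, 'a, 'k::finite) kgraph \<Rightarrow> 'a \<Rightarrow> 'a \<Rightarrow> 'a set" where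
  "mce \<Lambda> \<mu> \<nu> = {\<rho> \<in> Mor \<Lambda>.
     (\<exists>\<mu>' \<nu>'. (\<mu>, \<mu>') \<in> composable \<Lambda> \<and> (\<nu>, \<nu>') \<in> composable \<Lambda> \<and>
        \<rho> = cmp \<Lambda> \<mu> \<mu>' \<and> \<rho> = cmp \<Lambda> \<nu> \<nu>') \<and>
     deg \<Lambda> \<rho> = deg \<Lambda> \<mu> \<squnion>\<^sub>v deg \<Lambda> \<nu>}"

definition MCE :: "('v, 'a, 'k::finite) kgraph \<Rightarrow> 'a set \<Rightarrow> 'a set \<Rightarrow> 'a set" where
  "MCE \<Lambda> X Y = (\<Union>\<mu>\<in>X. \<Union>\<nu>\<in>Y. mce \<Lambda> \<mu> \<nu>)"

definition compactly_aligned :: "('v, 'a, 'k::finite) kgraph \<Rightarrow> bool" where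
  "compactly_aligned \<Lambda> \<longleftrightarrow>
     (\<forall>X Y. compactin (mtop \<Lambda>) X \<and> compactin (mtop \<Lambda>) Y \<longrightarrow> compactin (mtop \<Lambda>) (MCE \<Lambda> X Y))"


section \<open>The path space\<close>

text \<open>The object \<open>(p,p)\<close> of \<open>\<Omega>\<^bsub>k,m\<^esub>\<close> is represented by \<open>p\<close>.\<close>

definition Omega :: "enat ^ 'k \<Rightarrow> (nat ^ 'k, (nat ^ 'k) \<times> (nat ^ 'k), 'k::finite) kgraph" where
  "Omega m = \<lparr>otop = discrete_topology {p. to_enat p \<le> m},
     mtop = discrete_topology {(p, q). p \<le> q \<and> to_enat q \<le> m},
     rng = fst, src = snd, idt = (\<lambda>p. (p, p)), cmp = (\<lambda>\<rho> \<mu>. (fst \<rho>, snd \<mu>)),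
     deg = (\<lambda>(p, q). q - p)\<rparr>"

text \<open>
  A functor is given by its map on morphisms: the map on objects is determined by the
  requirement that identities go to identities.
\<close>

definition continuous_degree_functor ::
  "('v, 'a, 'k::finite) kgraph \<Rightarrow> ('w, 'b, 'k::finite) kgraph \<Rightarrow> ('a \<Rightarrow> 'b) \<Rightarrow> bool" where
  "continuous_degree_functor \<Gamma> \<Lambda> f \<longleftrightarrow>
     continuous_map (mtop \<Gamma>) (mtop \<Lambda>) f \<and>
     (\<forall>\<rho>\<in>Mor \<Gamma>. f (idt \<Gamma> (rng \<Gamma> \<rho>)) = idt \<Lambda> (rng \<Lambda> (f \<rho>))) \<and>
     (\<forall>\<rho>\<in>Mor \<Gamma>. f (idt \<Gamma> (src \<Gamma> \<rho>)) = idt \<Lambda> (src \<Lambda> (f \<rho>))) \<and>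
     (\<forall>(\<rho>, \<mu>)\<in>composable \<Gamma>. f (cmp \<Gamma> \<rho> \<mu>) = cmp \<Lambda> (f \<rho>) (f \<mu>)) \<and>
     (\<forall>\<rho>\<in>Mor \<Gamma>. deg \<Lambda> (f \<rho>) = deg \<Gamma> \<rho>)"

text \<open>
  An element \<open>x\<close> of the path space is the pair of its degree \<open>d(x)\<close> and the functor on
  \<open>\<Omega>\<^bsub>k,d(x)\<^esub>\<close>. The functor is extensional, so that equality of such pairs is equality of
  functors.
\<close>

type_synonym ('a, 'k) gpath = "(enat ^ 'k) \<times> ((nat ^ 'k) \<times> (nat ^ 'k) \<Rightarrow> 'a)"

definition path_space :: "('v, 'a, 'k::finite) kgraph \<Rightarrow> ('a, 'k::finite) gpath set" where
  "path_space \<Lambda> = {(m, x). x \<in> extensional (Mor (Omega m)) \<and>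
     continuous_degree_functor (Omega m) \<Lambda> x}"

abbreviation pdeg :: "('a, 'k::finite) gpath \<Rightarrow> enat ^ 'k" where
  "pdeg x \<equiv> fst x"

abbreviation pseg :: "('a, 'k::finite) gpath \<Rightarrow> nat ^ 'k \<Rightarrow> nat ^ 'k \<Rightarrow> 'a" where
  "pseg x p q \<equiv> snd x (p, q)"

text \<open>The identity morphism \<open>x(m,m)\<close>, seen as an object of \<open>\<Lambda>\<close>.\<close>

definition vertex_at :: "('v, 'a, 'k::finite) kgraph \<Rightarrow> ('a, 'k::finite) gpath \<Rightarrow> nat ^ 'k \<Rightarrow> 'v" where
  "vertex_at \<Lambda> x m = rng \<Lambda> (pseg x m m)"

definition path_rng :: "('v, 'a, 'k::finite) kgraph \<Rightarrow> ('a, 'k::finite) gpath \<Rightarrow> 'v" where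
  "path_rng \<Lambda> x = vertex_at \<Lambda> x 0"

text \<open>The shift \<open>\<sigma>\<^sup>m x\<close>, for \<open>m \<le> d(x)\<close>; it is well defined by \<open>shift_ex1\<close> below.\<close>

definition shift :: "('v, 'a, 'k::finite) kgraph \<Rightarrow> nat ^ 'k \<Rightarrow> ('a, 'k::finite) gpath \<Rightarrow> ('a, 'k::finite) gpath" where
  "shift \<Lambda> m x = (THE y. y \<in> path_space \<Lambda> \<and> pdeg y = pdeg x - to_enat m \<and>
     (\<forall>n. to_enat n \<le> pdeg x - to_enat m \<longrightarrow> pseg y 0 n = pseg x m (m + n)))"

definition aperiodic :: "('v, 'a, 'k::finite) kgraph \<Rightarrow> ('a, 'k::finite) gpath \<Rightarrow> bool" where
  "aperiodic \<Lambda> x \<longleftrightarrow>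
     (\<forall>m n. to_enat m \<le> pdeg x \<and> to_enat n \<le> pdeg x \<and> shift \<Lambda> m x = shift \<Lambda> n x \<longrightarrow> m = n)"

definition compact_exhaustive :: "('v, 'a, 'k::finite) kgraph \<Rightarrow> 'v \<Rightarrow> 'a set \<Rightarrow> bool" where
  "compact_exhaustive \<Lambda> v E \<longleftrightarrow>
     compactin (mtop \<Lambda>) E \<and>
     (\<exists>U. openin (otop \<Lambda>) U \<and> v \<in> U \<and> U \<subseteq> rng \<Lambda> ` E) \<and>
     (\<forall>\<rho>\<in>paths_into \<Lambda> (rng \<Lambda> ` E). \<exists>\<mu>\<in>E. mce \<Lambda> \<rho> \<mu> \<noteq> {})"

definition boundary_paths :: "('v, 'a, 'k::finite) kgraph \<Rightarrow> ('a, 'k::finite) gpath set" where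
  "boundary_paths \<Lambda> = {x \<in> path_space \<Lambda>.
     \<forall>m E. to_enat m \<le> pdeg x \<and> compact_exhaustive \<Lambda> (vertex_at \<Lambda> x m) E \<longrightarrow>
       (\<exists>\<rho>\<in>E. to_enat (m + deg \<Lambda> \<rho>) \<le> pdeg x \<and> pseg x m (m + deg \<Lambda> \<rho>) = \<rho>)}"


section \<open>The three aperiodicity conditions\<close>

definition condition_A :: "('v, 'a, 'k::finite) kgraph \<Rightarrow> bool" where
  "condition_A \<Lambda> \<longleftrightarrow>
     (\<forall>V. openin (otop \<Lambda>) V \<and> V \<noteq> {} \<longrightarrow>
        (\<exists>x\<in>boundary_paths \<Lambda>. path_rng \<Lambda> x \<in> V \<and> aperiodic \<Lambda> x))"

definition condition_B :: "('v, 'a, 'k::finite) kgraph \<Rightarrow> bool" where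
  "condition_B \<Lambda> \<longleftrightarrow>
     (\<forall>V m n. openin (otop \<Lambda>) V \<and> V \<noteq> {} \<and> m \<noteq> n \<longrightarrow>
        (\<exists>\<rho>\<in>paths_into \<Lambda> V. m \<squnion>\<^sub>v n \<le> deg \<Lambda> \<rho> \<and>
           segment \<Lambda> \<rho> m (m + deg \<Lambda> \<rho> - (m \<squnion>\<^sub>v n)) \<noteq>
           segment \<Lambda> \<rho> n (n + deg \<Lambda> \<rho> - (m \<squnion>\<^sub>v n))))"

definition condition_C :: "('v, 'a, 'k::finite) kgraph \<Rightarrow> bool" where
  "condition_C \<Lambda> \<longleftrightarrow>
     (\<forall>X Y. openin (mtop \<Lambda>) X \<and> openin (mtop \<Lambda>) Y \<and> X \<noteq> Y \<and>
        src \<Lambda> ` X = src \<Lambda> ` Y \<and>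
        homeomorphic_map (subtopology (mtop \<Lambda>) X) (subtopology (otop \<Lambda>) (src \<Lambda> ` X)) (src \<Lambda>) \<and>
        homeomorphic_map (subtopology (mtop \<Lambda>) Y) (subtopology (otop \<Lambda>) (src \<Lambda> ` Y)) (src \<Lambda>) \<longrightarrow>
        (\<exists>\<tau>\<in>paths_into \<Lambda> (src \<Lambda> ` X). MCE \<Lambda> (set_cmp \<Lambda> X {\<tau>}) (set_cmp \<Lambda> Y {\<tau>}) = {}))"


section \<open>Segments and shifts are well defined\<close>

lemma (in topological_kgraph) factorization_eq:
  assumes "(\<mu>, \<nu>) \<in> composable \<Lambda>" "(\<mu>', \<nu>') \<in> composable \<Lambda>"
    and "cmp \<Lambda> \<mu> \<nu> = cmp \<Lambda> \<mu>' \<nu>'" "deg \<Lambda> \<mu> = deg \<Lambda> \<mu>'" "deg \<Lambda> \<nu> = deg \<Lambda> \<nu>'"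
  shows "\<mu> = \<mu>' \<and> \<nu> = \<nu>'"
proof -
  have "\<exists>!(a, b). (a, b) \<in> composable \<Lambda> \<and> deg \<Lambda> a = deg \<Lambda> \<mu> \<and> deg \<Lambda> b = deg \<Lambda> \<nu> \<and>
      cmp \<Lambda> \<mu> \<nu> = cmp \<Lambda> a b"
    by (rule unique_factorization) (use assms cmp_Mor deg_cmp in auto)
  then obtain c where c: "\<And>a b. (a, b) \<in> composable \<Lambda> \<and> deg \<Lambda> a = deg \<Lambda> \<mu> \<and> deg \<Lambda> b = deg \<Lambda> \<nu> \<and>
      cmp \<Lambda> \<mu> \<nu> = cmp \<Lambda> a b \<Longrightarrow> (a, b) = c"
    unfolding Ex1_def by (metis (mono_tags, lifting) case_prodI)
  show ?thesis
    using c[of \<mu> \<nu>] c[of \<mu>' \<nu>'] assms by simp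
qed

lemma vec_diff_add [simp]: "(p::nat ^ 'k) \<le> q \<Longrightarrow> p + (q - p) = q"
  by (simp add: less_eq_vec_def vec_eq_iff)

lemma (in topological_kgraph) segment_ex1:
  assumes "\<rho> \<in> Mor \<Lambda>" "p \<le> q" "q \<le> deg \<Lambda> \<rho>"
  shows "\<exists>!\<mu>. \<mu> \<in> Mor \<Lambda> \<and> deg \<Lambda> \<mu> = q - p \<and>
     (\<exists>\<rho>' \<rho>''. (\<rho>', \<mu>) \<in> composable \<Lambda> \<and> (\<mu>, \<rho>'') \<in> composable \<Lambda> \<and>
        deg \<Lambda> \<rho>' = p \<and> deg \<Lambda> \<rho>'' = deg \<Lambda> \<rho> - q \<and> \<rho> = cmp \<Lambda> (cmp \<Lambda> \<rho>' \<mu>) \<rho>'')"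
proof (rule ex_ex1I)
  have "deg \<Lambda> \<rho> = q + (deg \<Lambda> \<rho> - q)" using assms by simp
  then obtain \<alpha> \<rho>'' where 1: "(\<alpha>, \<rho>'') \<in> composable \<Lambda>" "deg \<Lambda> \<alpha> = q"
      "deg \<Lambda> \<rho>'' = deg \<Lambda> \<rho> - q" "\<rho> = cmp \<Lambda> \<alpha> \<rho>''"
    using unique_factorization[OF assms(1)] by blast
  have \<alpha>: "\<alpha> \<in> Mor \<Lambda>" using 1(1) by (simp add: composable_def)
  have "deg \<Lambda> \<alpha> = p + (q - p)" using assms(2) 1(2) by simp
  then obtain \<rho>' \<mu> where 2: "(\<rho>', \<mu>) \<in> composable \<Lambda>" "deg \<Lambda> \<rho>' = p"
      "deg \<Lambda> \<mu> = q - p" "\<alpha> = cmp \<Lambda> \<rho>' \<mu>"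
    using unique_factorization[OF \<alpha>] by blast
  have "src \<Lambda> \<alpha> = src \<Lambda> \<mu>" using 2(1,4) src_cmp by simp
  then have "\<mu> \<in> Mor \<Lambda>" "(\<mu>, \<rho>'') \<in> composable \<Lambda>"
    using 1(1) 2(1) by (auto simp: composable_def)
  then show "\<exists>\<mu>. \<mu> \<in> Mor \<Lambda> \<and> deg \<Lambda> \<mu> = q - p \<and>
     (\<exists>\<rho>' \<rho>''. (\<rho>', \<mu>) \<in> composable \<Lambda> \<and> (\<mu>, \<rho>'') \<in> composable \<Lambda> \<and>
        deg \<Lambda> \<rho>' = p \<and> deg \<Lambda> \<rho>'' = deg \<Lambda> \<rho> - q \<and> \<rho> = cmp \<Lambda> (cmp \<Lambda> \<rho>' \<mu>) \<rho>'')"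
    using 1 2 by blast
next
  fix \<mu> \<nu>
  assume "\<mu> \<in> Mor \<Lambda> \<and> deg \<Lambda> \<mu> = q - p \<and>
     (\<exists>\<rho>' \<rho>''. (\<rho>', \<mu>) \<in> composable \<Lambda> \<and> (\<mu>, \<rho>'') \<in> composable \<Lambda> \<and>
        deg \<Lambda> \<rho>' = p \<and> deg \<Lambda> \<rho>'' = deg \<Lambda> \<rho> - q \<and> \<rho> = cmp \<Lambda> (cmp \<Lambda> \<rho>' \<mu>) \<rho>'')"
  then obtain a b where 1: "(a, \<mu>) \<in> composable \<Lambda>" "(\<mu>, b) \<in> composable \<Lambda>"
      "deg \<Lambda> a = p" "deg \<Lambda> b = deg \<Lambda> \<rho> - q" "\<rho> = cmp \<Lambda> (cmp \<Lambda> a \<mu>) b" "deg \<Lambda> \<mu> = q - p" by blast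
  assume "\<nu> \<in> Mor \<Lambda> \<and> deg \<Lambda> \<nu> = q - p \<and>
     (\<exists>\<rho>' \<rho>''. (\<rho>', \<nu>) \<in> composable \<Lambda> \<and> (\<nu>, \<rho>'') \<in> composable \<Lambda> \<and>
        deg \<Lambda> \<rho>' = p \<and> deg \<Lambda> \<rho>'' = deg \<Lambda> \<rho> - q \<and> \<rho> = cmp \<Lambda> (cmp \<Lambda> \<rho>' \<nu>) \<rho>'')"
  then obtain c d where 2: "(c, \<nu>) \<in> composable \<Lambda>" "(\<nu>, d) \<in> composable \<Lambda>"
      "deg \<Lambda> c = p" "deg \<Lambda> d = deg \<Lambda> \<rho> - q" "\<rho> = cmp \<Lambda> (cmp \<Lambda> c \<nu>) d" "deg \<Lambda> \<nu> = q - p" by blast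
  have comp: "(cmp \<Lambda> a \<mu>, b) \<in> composable \<Lambda>" "(cmp \<Lambda> c \<nu>, d) \<in> composable \<Lambda>"
    using 1(1,2) 2(1,2) src_cmp cmp_Mor by (auto simp: composable_def)
  have "cmp \<Lambda> a \<mu> = cmp \<Lambda> c \<nu>"
    using factorization_eq[OF comp] deg_cmp[OF 1(1)] deg_cmp[OF 2(1)]
    by (metis 1(3,4,5,6) 2(3,4,5,6))
  then show "\<mu> = \<nu>"
    using factorization_eq[OF 1(1) 2(1)] by (simp only: 1(3,6) 2(3,6))
qed

lemma Mor_Omega [simp]: "(p, q) \<in> Mor (Omega m) \<longleftrightarrow> p \<le> q \<and> to_enat q \<le> m"
  by (simp add: Omega_def)

lemma to_enat_le_mono: "to_enat t \<le> m \<Longrightarrow> q \<le> t \<Longrightarrow> to_enat q \<le> m"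
  unfolding less_eq_vec_def to_enat_nth by (meson enat_ord_simps(1) order_trans)

lemma continuous_degree_functor_Omega:
  "continuous_degree_functor (Omega m) \<Lambda> x \<longleftrightarrow>
     (\<forall>p q. p \<le> q \<and> to_enat q \<le> m \<longrightarrow>
        x (p, q) \<in> Mor \<Lambda> \<and> x (p, p) = idt \<Lambda> (rng \<Lambda> (x (p, q))) \<and>
        x (q, q) = idt \<Lambda> (src \<Lambda> (x (p, q))) \<and> deg \<Lambda> (x (p, q)) = q - p) \<and>
     (\<forall>p q t. p \<le> q \<and> q \<le> t \<and> to_enat t \<le> m \<longrightarrow> x (p, t) = cmp \<Lambda> (x (p, q)) (x (q, t)))"
proof -
  have "continuous_degree_functor (Omega m) \<Lambda> x \<longleftrightarrow>
     (\<forall>p q. p \<le> q \<and> to_enat q \<le> m \<longrightarrow> x (p, q) \<in> Mor \<Lambda>) \<and>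
     (\<forall>p q. p \<le> q \<and> to_enat q \<le> m \<longrightarrow> x (p, p) = idt \<Lambda> (rng \<Lambda> (x (p, q)))) \<and>
     (\<forall>p q. p \<le> q \<and> to_enat q \<le> m \<longrightarrow> x (q, q) = idt \<Lambda> (src \<Lambda> (x (p, q)))) \<and>
     (\<forall>p q t. p \<le> q \<and> to_enat q \<le> m \<and> q \<le> t \<and> to_enat t \<le> m \<longrightarrow>
        x (p, t) = cmp \<Lambda> (x (p, q)) (x (q, t))) \<and>
     (\<forall>p q. p \<le> q \<and> to_enat q \<le> m \<longrightarrow> deg \<Lambda> (x (p, q)) = q - p)"
    by (simp add: continuous_degree_functor_def Omega_def composable_def Pi_def Ball_def
        split_paired_All)
  then show ?thesis
    using to_enat_le_mono by meson
qed

lemma (in topological_kgraph) functor_composable: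
  assumes "continuous_degree_functor (Omega m) \<Lambda> x" "p \<le> q" "q \<le> t" "to_enat t \<le> m"
  shows "(x (p, q), x (q, t)) \<in> composable \<Lambda>"
proof -
  have F: "x (p, q) \<in> Mor \<Lambda>" "x (q, t) \<in> Mor \<Lambda>"
    "x (q, q) = idt \<Lambda> (src \<Lambda> (x (p, q)))" "x (q, q) = idt \<Lambda> (rng \<Lambda> (x (q, t)))"
    using assms to_enat_le_mono[OF assms(4,3)] unfolding continuous_degree_functor_Omega by blast+
  have "src \<Lambda> (x (p, q)) = rng \<Lambda> (x (q, t))"
    using F rng_idt src_Obj rng_Obj by metis
  then show ?thesis
    using F by (simp add: composable_def)
qed

lemma to_enat_le_diff:
  assumes "to_enat m \<le> d"
  shows "to_enat n \<le> d - to_enat m \<longleftrightarrow> to_enat (m + n) \<le> d"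
proof -
  have "enat (n $ i) \<le> d $ i - enat (m $ i) \<longleftrightarrow> enat (m $ i + n $ i) \<le> d $ i" for i
    using assms by (cases "d $ i") (auto simp: less_eq_vec_def dest: spec[of _ i])
  then show ?thesis
    by (simp add: less_eq_vec_def)
qed

lemma (in topological_kgraph) shift_ex1:
  assumes x: "x \<in> path_space \<Lambda>" and m: "to_enat m \<le> pdeg x"
  shows "\<exists>!y. y \<in> path_space \<Lambda> \<and> pdeg y = pdeg x - to_enat m \<and>
     (\<forall>n. to_enat n \<le> pdeg x - to_enat m \<longrightarrow> pseg y 0 n = pseg x m (m + n))"
proof (rule ex_ex1I)
  obtain d f where xdf: "x = (d, f)" by (cases x)
  define e where "e = d - to_enat m"
  have f: "continuous_degree_functor (Omega d) \<Lambda> f"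
    using x by (simp add: xdf path_space_def)
  have le: "to_enat n \<le> e \<longleftrightarrow> to_enat (m + n) \<le> d" for n
    using m to_enat_le_diff[of m d n] by (simp add: xdf e_def)
  have add_le: "m + p \<le> m + q \<longleftrightarrow> p \<le> q" for p q
    by (simp add: less_eq_vec_def)
  have diff: "(m + q) - (m + p) = q - p" for p q
    by (simp add: vec_eq_iff)
  define g where "g = restrict (\<lambda>(p, q). f (m + p, m + q)) (Mor (Omega e))"
  have g: "g (p, q) = f (m + p, m + q)" if "p \<le> q" "to_enat q \<le> e" for p q
    using that by (simp add: g_def)
  have "continuous_degree_functor (Omega e) \<Lambda> g"
    unfolding continuous_degree_functor_Omega
  proof (intro conjI allI impI; elim conjE)
    fix p q assume pq: "p \<le> q" "to_enat q \<le> e"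
    then have pe: "to_enat p \<le> e" using to_enat_le_mono by blast
    have G: "g (p, q) = f (m + p, m + q)" "g (p, p) = f (m + p, m + p)" "g (q, q) = f (m + q, m + q)"
      using g pq pe by auto
    have "m + p \<le> m + q" "to_enat (m + q) \<le> d" using pq add_le le by auto
    then show "g (p, q) \<in> Mor \<Lambda>" "g (p, p) = idt \<Lambda> (rng \<Lambda> (g (p, q)))"
      "g (q, q) = idt \<Lambda> (src \<Lambda> (g (p, q)))" "deg \<Lambda> (g (p, q)) = q - p"
      using f diff[of q p] unfolding continuous_degree_functor_Omega G by metis+
  next
    fix p q t assume pq: "p \<le> q" "q \<le> t" "to_enat t \<le> e"
    then have G: "g (p, t) = f (m + p, m + t)" "g (p, q) = f (m + p, m + q)"
        "g (q, t) = f (m + q, m + t)"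
      using g to_enat_le_mono by (meson order_trans)+
    have "m + p \<le> m + q" "m + q \<le> m + t" "to_enat (m + t) \<le> d" using pq add_le le by auto
    then show "g (p, t) = cmp \<Lambda> (g (p, q)) (g (q, t))"
      using f unfolding continuous_degree_functor_Omega G by blast
  qed
  moreover have "g \<in> extensional (Mor (Omega e))"
    by (simp add: g_def)
  ultimately have "(e, g) \<in> path_space \<Lambda>"
    by (simp add: path_space_def)
  moreover have "g (0, n) = f (m, m + n)" if "to_enat n \<le> e" for n
    using g[of 0 n] that by (simp add: less_eq_vec_def)
  ultimately show "\<exists>y. y \<in> path_space \<Lambda> \<and> pdeg y = pdeg x - to_enat m \<and>
     (\<forall>n. to_enat n \<le> pdeg x - to_enat m \<longrightarrow> pseg y 0 n = pseg x m (m + n))"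
    by (intro exI[of _ "(e, g)"]) (simp add: xdf e_def)
next
  fix y z
  define e where "e = pdeg x - to_enat m"
  assume "y \<in> path_space \<Lambda> \<and> pdeg y = pdeg x - to_enat m \<and>
     (\<forall>n. to_enat n \<le> pdeg x - to_enat m \<longrightarrow> pseg y 0 n = pseg x m (m + n))"
  then obtain g where y: "y = (e, g)" "g \<in> extensional (Mor (Omega e))"
      "continuous_degree_functor (Omega e) \<Lambda> g"
      "\<And>n. to_enat n \<le> e \<Longrightarrow> g (0, n) = pseg x m (m + n)"
    by (cases y) (auto simp: path_space_def e_def)
  assume "z \<in> path_space \<Lambda> \<and> pdeg z = pdeg x - to_enat m \<and>
     (\<forall>n. to_enat n \<le> pdeg x - to_enat m \<longrightarrow> pseg z 0 n = pseg x m (m + n))"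
  then obtain h where z: "z = (e, h)" "h \<in> extensional (Mor (Omega e))"
      "continuous_degree_functor (Omega e) \<Lambda> h"
      "\<And>n. to_enat n \<le> e \<Longrightarrow> h (0, n) = pseg x m (m + n)"
    by (cases z) (auto simp: path_space_def e_def)
  have "g (p, q) = h (p, q)" if pq: "p \<le> q" "to_enat q \<le> e" for p q
  proof -
    have 0: "0 \<le> p" "to_enat p \<le> e" 
      using to_enat_le_mono[OF pq(2,1)] by (simp_all add: less_eq_vec_def)
    have C: "(g (0, p), g (p, q)) \<in> composable \<Lambda>" "(h (0, p), h (p, q)) \<in> composable \<Lambda>"
      using functor_composable y(3) z(3) 0 pq by blast+
    have "cmp \<Lambda> (g (0, p)) (g (p, q)) = g (0, q)" "cmp \<Lambda> (h (0, p)) (h (p, q)) = h (0, q)"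
      "deg \<Lambda> (g (p, q)) = q - p" "deg \<Lambda> (h (p, q)) = q - p"
      using y(3) z(3) 0 pq unfolding continuous_degree_functor_Omega by metis+
    then show ?thesis
      using factorization_eq[OF C] y(4) z(4) 0 pq by simp
  qed
  then have "g = h"
    by (intro extensionalityI[OF y(2) z(2)]) auto
  then show "y = z"
    using y z by simp
qed

end

theory Submission
  imports Defs
begin

text \<open>
  All three conditions say that no two different shifts \<open>\<sigma>\<^sup>m\<close> and \<open>\<sigma>\<^sup>n\<close> agree on all paths that
  start in some nonempty open set of vertices. Condition (B) fails exactly when there is a nonempty
  open \<open>V\<close> on which, in the sense of \<open>periodic_on\<close>, \<open>\<sigma>\<^sup>m = \<sigma>\<^sup>n\<close> with \<open>m \<noteq> n\<close>. Passing from \<open>V\<close> to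
  the vertices that are the sources of paths of degree \<open>m \<and> n\<close> with range in \<open>V\<close>, one may assume
  that \<open>m \<and> n = 0\<close>, that is \<open>m \<or> n = m + n\<close> (\<open>not_condition_B_imp_periodic\<close>). Under such a
  periodicity a path \<open>\<rho>\<close> of degree \<open>m + n\<close> with range in \<open>V\<close> has two tails, \<open>\<beta>\<close> of degree \<open>n\<close> and
  \<open>\<gamma>\<close> of degree \<open>m\<close>, which share their range and their source, and \<open>\<beta>\<tau>\<close> and \<open>\<gamma>\<tau>\<close> have a common
  extension for every \<open>\<tau>\<close> (\<open>periodic_tails_mce\<close>). This pair of tails drives two of the four
  implications.

  (C) implies (B): as \<open>\<rho>\<close> varies in a small open set on which \<open>s\<close> is injective, its two tails sweep
  out two open sets that violate (C). They are open because \<open>s\<close> is a local homeomorphism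
  (\<open>openin_tails\<close>).

  (A) implies (B): if \<open>\<rho>\<close> varies in a compact set \<open>N\<close>, the tails form compact sets \<open>X\<close> and \<open>Y\<close>.
  Periodicity forces every path \<open>\<beta>\<sigma>\<close> with \<open>\<beta>\<close> in \<open>X\<close> and \<open>\<sigma>\<close> of degree \<open>m\<close> to lie in
  \<open>MCE X Y\<close>, which is compact by compact alignment. Hence \<open>s(N)\<Lambda>\<^sup>m\<close> is compact
  (\<open>periodic_compact_fibres\<close>), and since there are no sources it is exhaustive. A boundary path through
  such vertices must therefore keep extending in every direction in which \<open>m\<close> or \<open>n\<close> is nonzero. So
  \<open>\<sigma>\<^sup>m x\<close> and \<open>\<sigma>\<^sup>n x\<close> are both defined, have the same degree and coincide: no boundary path over
  these vertices is aperiodic.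

  (B) implies (C): if two paths with the same source have different degrees \<open>m\<close> and \<open>n\<close>, apply (B) at
  that source to the complementary degrees \<open>m' = (m \<or> n) - m\<close> and \<open>n' = (m \<or> n) - n\<close>. A path \<open>\<tau>\<close> with
  \<open>\<sigma>\<^sup>m\<^sup>' \<tau> \<noteq> \<sigma>\<^sup>n\<^sup>' \<tau>\<close> cannot be reconciled in a common extension, where both are \<open>\<sigma>\<^bsup>m \<or> n\<^esup>\<close>.

  (B) implies (A): a Baire-type argument. Enumerate all pairs \<open>(m, n)\<close> and build nested compact sets of
  longer and longer paths with nonempty interior, where each step separates \<open>\<sigma>\<^sup>m\<close> from \<open>\<sigma>\<^sup>n\<close> for one
  pair (\<open>compact_patch_refine\<close>); this is possible since segments depend continuously on the path. A
  point of the inverse limit is a path that is infinite in all directions, hence a boundary path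
  (\<open>infinite_path_boundary\<close>), and aperiodic by construction.
\<close>

section \<open>Arithmetic of degrees\<close>

text \<open>
  With the coordinatewise order, \<open>\<nat>\<^sup>k\<close> is an ordered cancellative monoid with truncated difference, just
  as \<open>\<nat>\<close> is. The following instances make the arithmetic of such monoids apply to degrees.
\<close>

instance vec :: (ordered_ab_semigroup_add, finite) ordered_ab_semigroup_add
  by standard (simp add: less_eq_vec_def add_left_mono)

instance vec :: (ordered_cancel_ab_semigroup_add, finite) ordered_cancel_ab_semigroup_add ..

instance vec :: (ordered_ab_semigroup_add_imp_le, finite) ordered_ab_semigroup_add_imp_le
  by standard (simp add: less_eq_vec_def)

instance vec :: (ordered_comm_monoid_add, finite) ordered_comm_monoid_add ..

instance vec :: (ordered_cancel_comm_monoid_add, finite) ordered_cancel_comm_monoid_add ..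

instance vec :: (comm_monoid_diff, finite) comm_monoid_diff
  by standard (simp_all add: vec_eq_iff diff_diff_add)

instance vec :: (canonically_ordered_monoid_add, finite) canonically_ordered_monoid_add
proof
  fix a b :: "'a ^ 'b"
  show "a \<le> b \<longleftrightarrow> (\<exists>c. b = a + c)"
  proof
    assume "a \<le> b"
    then have "\<forall>i. \<exists>c. b $ i = a $ i + c"
      by (simp add: less_eq_vec_def le_iff_add)
    then obtain f where "\<forall>i. b $ i = a $ i + f i"
      by metis
    then show "\<exists>c. b = a + c"
      by (intro exI[of _ "\<chi> i. f i"]) (simp add: vec_eq_iff)
  next
    assume "\<exists>c. b = a + c"
    then show "a \<le> b"
      unfolding less_eq_vec_def by (metis le_iff_add vector_add_component)
  qed
qed

instance vec :: (ordered_cancel_comm_monoid_diff, finite) ordered_cancel_comm_monoid_diff ..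

lemma vjoin_commute: "m \<squnion>\<^sub>v n = n \<squnion>\<^sub>v m"
  by (simp add: vec_eq_iff max.commute)

lemma vjoin_upper: "m \<le> m \<squnion>\<^sub>v n" "n \<le> m \<squnion>\<^sub>v n"
  by (simp_all add: less_eq_vec_def)

lemma vjoin_absorb: "m \<le> n \<Longrightarrow> n \<squnion>\<^sub>v m = n"
  by (simp add: less_eq_vec_def vec_eq_iff max.absorb1)

lemma vjoin_add: "(m + q) \<squnion>\<^sub>v (n + q) = (m \<squnion>\<^sub>v n) + q"
  by (simp add: vec_eq_iff max_def)

lemma vec_le_add [simp]: "(m :: nat ^ 'k) \<le> m + n" "n \<le> m + n"
  by (simp_all add: less_eq_vec_def)

lemma vec_diff_add_diff: "(p :: nat ^ 'k) \<le> q \<Longrightarrow> q \<le> t \<Longrightarrow> (q - p) + (t - q) = t - p"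
  using ordered_cancel_comm_monoid_diff_class.add_diff_assoc2[of p q "t - q"] by simp

lemma finite_vec_bounded:
  fixes D :: "(nat ^ 'n) set"
  assumes "finite D"
  obtains q where "\<forall>d\<in>D. d \<le> q"
proof -
  have "\<forall>d\<in>D. d \<le> \<Sum>D"
    using sum.remove[OF assms, of _ "\<lambda>d. d"] by simp
  then show ?thesis by (rule that)
qed

lemma to_enat_le_infinite: "(\<And>i. d $ i = \<infinity>) \<Longrightarrow> to_enat q \<le> d"
  by (simp add: less_eq_vec_def)

section \<open>Factorizations and segments\<close>


context topological_kgraph
begin


lemma composableD:
  assumes "(\<mu>, \<nu>) \<in> composable \<Lambda>"
  shows "\<mu> \<in> Mor \<Lambda>" "\<nu> \<in> Mor \<Lambda>" "src \<Lambda> \<mu> = rng \<Lambda> \<nu>"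
  using assms by (auto simp: composable_def)

lemma composable_assoc:
  assumes "(\<mu>, \<nu>) \<in> composable \<Lambda>" "(\<nu>, \<xi>) \<in> composable \<Lambda>"
  shows "(\<mu>, cmp \<Lambda> \<nu> \<xi>) \<in> composable \<Lambda>" "(cmp \<Lambda> \<mu> \<nu>, \<xi>) \<in> composable \<Lambda>"
  using assms by (simp_all add: composable_def cmp_Mor rng_cmp src_cmp)

lemma composable_cmp_leftD:
  assumes "(\<mu>, \<nu>) \<in> composable \<Lambda>" "(cmp \<Lambda> \<mu> \<nu>, \<xi>) \<in> composable \<Lambda>"
  shows "(\<nu>, \<xi>) \<in> composable \<Lambda>"
  using assms by (simp add: composable_def src_cmp[OF assms(1)])

lemma composable_cmp_rightD:
  assumes "(\<nu>, \<xi>) \<in> composable \<Lambda>" "(\<mu>, cmp \<Lambda> \<nu> \<xi>) \<in> composable \<Lambda>"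
  shows "(\<mu>, \<nu>) \<in> composable \<Lambda>"
  using assms by (simp add: composable_def rng_cmp[OF assms(1)])

lemma factorize:
  assumes "\<rho> \<in> Mor \<Lambda>" "deg \<Lambda> \<rho> = m + n"
  obtains \<mu> \<nu> where "(\<mu>, \<nu>) \<in> composable \<Lambda>" "deg \<Lambda> \<mu> = m" "deg \<Lambda> \<nu> = n" "\<rho> = cmp \<Lambda> \<mu> \<nu>"
  using unique_factorization[OF assms] by blast

lemma factorize3:
  assumes "\<rho> \<in> Mor \<Lambda>" "deg \<Lambda> \<rho> = l + m + n"
  obtains \<mu> \<nu> \<xi> where "(\<mu>, \<nu>) \<in> composable \<Lambda>" "(\<nu>, \<xi>) \<in> composable \<Lambda>"
    "deg \<Lambda> \<mu> = l" "deg \<Lambda> \<nu> = m" "deg \<Lambda> \<xi> = n" "\<rho> = cmp \<Lambda> \<mu> (cmp \<Lambda> \<nu> \<xi>)"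
proof -
  obtain \<mu> \<omega> where 1: "(\<mu>, \<omega>) \<in> composable \<Lambda>" "deg \<Lambda> \<mu> = l" "deg \<Lambda> \<omega> = m + n" "\<rho> = cmp \<Lambda> \<mu> \<omega>"
    using factorize[OF assms(1), of l "m + n"] assms(2) by (auto simp: add.assoc)
  obtain \<nu> \<xi> where 2: "(\<nu>, \<xi>) \<in> composable \<Lambda>" "deg \<Lambda> \<nu> = m" "deg \<Lambda> \<xi> = n" "\<omega> = cmp \<Lambda> \<nu> \<xi>"
    using factorize[OF composableD(2)[OF 1(1)] 1(3)] by blast
  show ?thesis
    using that[of \<mu> \<nu> \<xi>] 1 2 composable_cmp_rightD by blast
qed

text \<open>
  Only the degrees of the left factors need to be compared, since addition in \<open>\<nat>\<^sup>k\<close> is cancellative.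
\<close>

lemma factorization_cancel:
  assumes "(\<mu>, \<nu>) \<in> composable \<Lambda>" "(\<mu>', \<nu>') \<in> composable \<Lambda>"
    and "cmp \<Lambda> \<mu> \<nu> = cmp \<Lambda> \<mu>' \<nu>'" "deg \<Lambda> \<mu> = deg \<Lambda> \<mu>'"
  shows "\<mu> = \<mu>'" "\<nu> = \<nu>'"
proof -
  have "deg \<Lambda> \<nu> = deg \<Lambda> \<nu>'"
    using deg_cmp[OF assms(1)] deg_cmp[OF assms(2)] assms(3,4) by simp
  then show "\<mu> = \<mu>'" "\<nu> = \<nu>'"
    using factorization_eq[OF assms(1-4)] by auto
qed

text \<open>
  Compare the two factorizations \<open>id \<cdot> \<rho> = \<rho> \<cdot> id\<close> of a path of degree \<open>0\<close>.
\<close>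

lemma deg_zero_eq_idt:
  assumes "\<rho> \<in> Mor \<Lambda>" "deg \<Lambda> \<rho> = 0"
  shows "\<rho> = idt \<Lambda> (rng \<Lambda> \<rho>)" "\<rho> = idt \<Lambda> (src \<Lambda> \<rho>)"
proof -
  have c: "(idt \<Lambda> (rng \<Lambda> \<rho>), \<rho>) \<in> composable \<Lambda>" "(\<rho>, idt \<Lambda> (src \<Lambda> \<rho>)) \<in> composable \<Lambda>"
    using assms by (simp_all add: composable_def idt_Mor rng_Obj src_Obj rng_idt src_idt)
  have e: "cmp \<Lambda> (idt \<Lambda> (rng \<Lambda> \<rho>)) \<rho> = cmp \<Lambda> \<rho> (idt \<Lambda> (src \<Lambda> \<rho>))"
    using idt_cmp cmp_idt assms by simp
  have d: "deg \<Lambda> (idt \<Lambda> (rng \<Lambda> \<rho>)) = deg \<Lambda> \<rho>"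
    using assms by (simp add: deg_idt rng_Obj)
  show "\<rho> = idt \<Lambda> (rng \<Lambda> \<rho>)" "\<rho> = idt \<Lambda> (src \<Lambda> \<rho>)"
    using factorization_cancel[OF c e d] by auto
qed

text \<open>
  All computations with segments go through this characterization: to read off a segment it is
  enough to exhibit a factorization into three paths.
\<close>

lemma segment_cmp:
  assumes "(\<mu>, \<nu>) \<in> composable \<Lambda>" "(\<nu>, \<xi>) \<in> composable \<Lambda>"
    and p: "p = deg \<Lambda> \<mu>" and q: "q = deg \<Lambda> \<mu> + deg \<Lambda> \<nu>"
  shows "segment \<Lambda> (cmp \<Lambda> \<mu> (cmp \<Lambda> \<nu> \<xi>)) p q = \<nu>"
proof -
  let ?\<rho> = "cmp \<Lambda> \<mu> (cmp \<Lambda> \<nu> \<xi>)"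
  have d: "deg \<Lambda> ?\<rho> = deg \<Lambda> \<mu> + deg \<Lambda> \<nu> + deg \<Lambda> \<xi>"
    using assms composable_assoc by (simp add: deg_cmp add.assoc)
  have "?\<rho> \<in> Mor \<Lambda>"
    using assms composable_assoc cmp_Mor by blast
  moreover have "p \<le> q" "q \<le> deg \<Lambda> ?\<rho>"
    by (simp_all add: p q d)
  moreover have "\<nu> \<in> Mor \<Lambda>" "deg \<Lambda> \<nu> = q - p" "deg \<Lambda> \<xi> = deg \<Lambda> ?\<rho> - q"
      "?\<rho> = cmp \<Lambda> (cmp \<Lambda> \<mu> \<nu>) \<xi>"
    using assms(1,2) by (simp_all add: p q d composable_def cmp_assoc)
  ultimately show ?thesis
    unfolding segment_def using assms(1,2) p
    by (intro the1_equality[OF segment_ex1]) blast+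
qed

lemma segment_prefix:
  assumes "(\<mu>, \<nu>) \<in> composable \<Lambda>"
  shows "segment \<Lambda> (cmp \<Lambda> \<mu> \<nu>) 0 (deg \<Lambda> \<mu>) = \<mu>"
proof -
  have M: "\<mu> \<in> Mor \<Lambda>" using composableD[OF assms] by auto
  have c: "(idt \<Lambda> (rng \<Lambda> \<mu>), \<mu>) \<in> composable \<Lambda>"
    using M by (simp add: composable_def idt_Mor rng_Obj src_idt)
  have "cmp \<Lambda> (idt \<Lambda> (rng \<Lambda> \<mu>)) (cmp \<Lambda> \<mu> \<nu>) = cmp \<Lambda> \<mu> \<nu>"
    using idt_cmp[OF cmp_Mor[OF assms]] rng_cmp[OF assms] by simp
  then show ?thesis
    using segment_cmp[OF c assms] M by (simp add: deg_idt rng_Obj)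
qed

lemma segment_full:
  assumes "\<rho> \<in> Mor \<Lambda>"
  shows "segment \<Lambda> \<rho> 0 (deg \<Lambda> \<rho>) = \<rho>"
proof -
  have "(\<rho>, idt \<Lambda> (src \<Lambda> \<rho>)) \<in> composable \<Lambda>"
    using assms by (simp add: composable_def idt_Mor src_Obj rng_idt)
  from segment_prefix[OF this] show ?thesis
    using assms by (simp add: cmp_idt)
qed

text \<open>
  The segment is named by a variable \<open>\<sigma>\<close> of its own, because an equation for \<open>\<rho>\<close> whose right-hand
  side mentions a segment of \<open>\<rho>\<close> would make rewriting loop.
\<close>

lemma segment_factorization:
  assumes "\<rho> \<in> Mor \<Lambda>" "p \<le> q" "q \<le> deg \<Lambda> \<rho>"
  obtains \<mu> \<sigma> \<nu> where "segment \<Lambda> \<rho> p q = \<sigma>" "(\<mu>, \<sigma>) \<in> composable \<Lambda>" "(\<sigma>, \<nu>) \<in> composable \<Lambda>"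
    "deg \<Lambda> \<mu> = p" "deg \<Lambda> \<sigma> = q - p" "deg \<Lambda> \<nu> = deg \<Lambda> \<rho> - q"
    "\<rho> = cmp \<Lambda> \<mu> (cmp \<Lambda> \<sigma> \<nu>)"
proof -
  have "deg \<Lambda> \<rho> = p + (q - p) + (deg \<Lambda> \<rho> - q)"
    using assms(2,3) by simp
  from factorize3[OF assms(1) this] obtain \<mu> \<nu> \<xi> where f: "(\<mu>, \<nu>) \<in> composable \<Lambda>"
    "(\<nu>, \<xi>) \<in> composable \<Lambda>" "deg \<Lambda> \<mu> = p" "deg \<Lambda> \<nu> = q - p" "deg \<Lambda> \<xi> = deg \<Lambda> \<rho> - q"
    "\<rho> = cmp \<Lambda> \<mu> (cmp \<Lambda> \<nu> \<xi>)" .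
  have "segment \<Lambda> \<rho> p q = \<nu>"
    unfolding f(6) using f assms(2) by (intro segment_cmp) simp_all
  then show ?thesis using that f by blast
qed

lemma segment_Mor:
  "\<rho> \<in> Mor \<Lambda> \<Longrightarrow> p \<le> q \<Longrightarrow> q \<le> deg \<Lambda> \<rho> \<Longrightarrow> segment \<Lambda> \<rho> p q \<in> Mor \<Lambda>"
  by (erule (2) segment_factorization) (metis composableD(1))

lemma deg_segment:
  "\<rho> \<in> Mor \<Lambda> \<Longrightarrow> p \<le> q \<Longrightarrow> q \<le> deg \<Lambda> \<rho> \<Longrightarrow> deg \<Lambda> (segment \<Lambda> \<rho> p q) = q - p"
  by (erule (2) segment_factorization) metis

lemma cmp_segment:
  assumes "\<rho> \<in> Mor \<Lambda>" "p \<le> q" "q \<le> t" "t \<le> deg \<Lambda> \<rho>"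
  shows "(segment \<Lambda> \<rho> p q, segment \<Lambda> \<rho> q t) \<in> composable \<Lambda>"
    and "cmp \<Lambda> (segment \<Lambda> \<rho> p q) (segment \<Lambda> \<rho> q t) = segment \<Lambda> \<rho> p t"
proof -
  have pt: "p \<le> t" using assms by simp
  from segment_factorization[OF assms(1) pt assms(4)] obtain \<mu> \<sigma> \<xi> where
    f: "segment \<Lambda> \<rho> p t = \<sigma>" "(\<mu>, \<sigma>) \<in> composable \<Lambda>" "(\<sigma>, \<xi>) \<in> composable \<Lambda>"
      "deg \<Lambda> \<mu> = p" "deg \<Lambda> \<sigma> = t - p" "\<rho> = cmp \<Lambda> \<mu> (cmp \<Lambda> \<sigma> \<xi>)" .
  have "deg \<Lambda> \<sigma> = (q - p) + (t - q)"
    using assms(2,3) f(5) by (simp add: vec_diff_add_diff)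
  from factorize[OF composableD(2)[OF f(2)] this] obtain \<alpha> \<beta> where
    g: "(\<alpha>, \<beta>) \<in> composable \<Lambda>" "deg \<Lambda> \<alpha> = q - p" "deg \<Lambda> \<beta> = t - q" "\<sigma> = cmp \<Lambda> \<alpha> \<beta>" .
  have c: "(\<mu>, \<alpha>) \<in> composable \<Lambda>" "(\<beta>, \<xi>) \<in> composable \<Lambda>"
    using composable_cmp_rightD[OF g(1)] composable_cmp_leftD[OF g(1)] f(2,3) g(4) by auto
  have "\<rho> = cmp \<Lambda> \<mu> (cmp \<Lambda> \<alpha> (cmp \<Lambda> \<beta> \<xi>))" "\<rho> = cmp \<Lambda> (cmp \<Lambda> \<mu> \<alpha>) (cmp \<Lambda> \<beta> \<xi>)"
    using f(6) g(1,4) c composable_assoc by (simp_all add: cmp_assoc)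
  then have "segment \<Lambda> \<rho> p q = \<alpha>" "segment \<Lambda> \<rho> q t = \<beta>"
    using segment_cmp[of \<mu> \<alpha> "cmp \<Lambda> \<beta> \<xi>" p q] segment_cmp[of "cmp \<Lambda> \<mu> \<alpha>" \<beta> \<xi> q t]
      c g(1-3) f(4) assms(2,3) composable_assoc by (simp_all add: deg_cmp)
  then show "(segment \<Lambda> \<rho> p q, segment \<Lambda> \<rho> q t) \<in> composable \<Lambda>"
    "cmp \<Lambda> (segment \<Lambda> \<rho> p q) (segment \<Lambda> \<rho> q t) = segment \<Lambda> \<rho> p t"
    using g f(1) by auto
qed

lemma segment_cmp_left:
  assumes c: "(\<mu>, \<nu>) \<in> composable \<Lambda>" and "p \<le> q" "q \<le> deg \<Lambda> \<mu>"
  shows "segment \<Lambda> (cmp \<Lambda> \<mu> \<nu>) p q = segment \<Lambda> \<mu> p q"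
proof -
  from segment_factorization[OF composableD(1)[OF c] assms(2,3)] obtain \<alpha> \<sigma> \<beta> where
    f: "segment \<Lambda> \<mu> p q = \<sigma>" "(\<alpha>, \<sigma>) \<in> composable \<Lambda>" "(\<sigma>, \<beta>) \<in> composable \<Lambda>"
      "deg \<Lambda> \<alpha> = p" "deg \<Lambda> \<sigma> = q - p" "\<mu> = cmp \<Lambda> \<alpha> (cmp \<Lambda> \<sigma> \<beta>)" .
  have g: "(cmp \<Lambda> \<sigma> \<beta>, \<nu>) \<in> composable \<Lambda>"
    using composable_cmp_leftD[OF composable_assoc(1)[OF f(2,3)]] c f(6) by simp
  then have b: "(\<beta>, \<nu>) \<in> composable \<Lambda>"
    using composable_cmp_leftD[OF f(3)] by simp
  have "cmp \<Lambda> \<mu> \<nu> = cmp \<Lambda> \<alpha> (cmp \<Lambda> \<sigma> (cmp \<Lambda> \<beta> \<nu>))"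
    using cmp_assoc[OF composable_assoc(1)[OF f(2,3)] g] cmp_assoc[OF f(3) b] f(6) by simp
  then show ?thesis
    using segment_cmp[OF f(2) composable_assoc(1)[OF f(3) b], of p q] f assms(2) by simp
qed

lemma segment_cmp_right:
  assumes c: "(\<mu>, \<nu>) \<in> composable \<Lambda>" and "p \<le> q" "q \<le> deg \<Lambda> \<nu>"
  shows "segment \<Lambda> (cmp \<Lambda> \<mu> \<nu>) (deg \<Lambda> \<mu> + p) (deg \<Lambda> \<mu> + q) = segment \<Lambda> \<nu> p q"
proof -
  from segment_factorization[OF composableD(2)[OF c] assms(2,3)] obtain \<alpha> \<sigma> \<beta> where
    f: "segment \<Lambda> \<nu> p q = \<sigma>" "(\<alpha>, \<sigma>) \<in> composable \<Lambda>" "(\<sigma>, \<beta>) \<in> composable \<Lambda>"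
      "deg \<Lambda> \<alpha> = p" "deg \<Lambda> \<sigma> = q - p" "\<nu> = cmp \<Lambda> \<alpha> (cmp \<Lambda> \<sigma> \<beta>)" .
  have b: "(\<mu>, \<alpha>) \<in> composable \<Lambda>"
    using composable_cmp_rightD[OF composable_assoc(1)[OF f(2,3)]] c f(6) by simp
  have "cmp \<Lambda> \<mu> \<nu> = cmp \<Lambda> (cmp \<Lambda> \<mu> \<alpha>) (cmp \<Lambda> \<sigma> \<beta>)"
    using cmp_assoc[OF b composable_assoc(1)[OF f(2,3)]] f(6) by simp
  moreover have "deg \<Lambda> \<mu> + q = deg \<Lambda> (cmp \<Lambda> \<mu> \<alpha>) + deg \<Lambda> \<sigma>"
    using deg_cmp[OF b] f(4,5) assms(2) by (simp add: add.assoc)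
  moreover have "deg \<Lambda> \<mu> + p = deg \<Lambda> (cmp \<Lambda> \<mu> \<alpha>)"
    using deg_cmp[OF b] f(4) by simp
  ultimately show ?thesis
    using segment_cmp[OF composable_assoc(2)[OF b f(2)] f(3)] f(1) by simp
qed

lemma segment_suffix:
  assumes "(\<mu>, \<nu>) \<in> composable \<Lambda>"
  shows "segment \<Lambda> (cmp \<Lambda> \<mu> \<nu>) (deg \<Lambda> \<mu>) (deg \<Lambda> \<mu> + deg \<Lambda> \<nu>) = \<nu>"
proof -
  have "segment \<Lambda> (cmp \<Lambda> \<mu> \<nu>) (deg \<Lambda> \<mu> + 0) (deg \<Lambda> \<mu> + deg \<Lambda> \<nu>) = segment \<Lambda> \<nu> 0 (deg \<Lambda> \<nu>)"
    by (rule segment_cmp_right[OF assms]) simp_all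
  then show ?thesis
    using segment_full[OF composableD(2)[OF assms]] by simp
qed

lemma segment_segment_prefix:
  assumes "\<rho> \<in> Mor \<Lambda>" "p \<le> q" "q \<le> t" "t \<le> deg \<Lambda> \<rho>"
  shows "segment \<Lambda> (segment \<Lambda> \<rho> 0 t) p q = segment \<Lambda> \<rho> p q"
proof -
  have "cmp \<Lambda> (segment \<Lambda> \<rho> 0 t) (segment \<Lambda> \<rho> t (deg \<Lambda> \<rho>)) = \<rho>"
    "(segment \<Lambda> \<rho> 0 t, segment \<Lambda> \<rho> t (deg \<Lambda> \<rho>)) \<in> composable \<Lambda>"
    "deg \<Lambda> (segment \<Lambda> \<rho> 0 t) = t"
    using cmp_segment[of \<rho> 0 t "deg \<Lambda> \<rho>"] assms segment_full[OF assms(1)] by (auto simp: deg_segment)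
  then show ?thesis
    using segment_cmp_left[of "segment \<Lambda> \<rho> 0 t" "segment \<Lambda> \<rho> t (deg \<Lambda> \<rho>)" p q] assms by simp
qed

lemma segment_segment:
  assumes "\<rho> \<in> Mor \<Lambda>" "p + t \<le> deg \<Lambda> \<rho>" "a \<le> b" "b \<le> t"
  shows "segment \<Lambda> (segment \<Lambda> \<rho> p (p + t)) a b = segment \<Lambda> \<rho> (p + a) (p + b)"
proof -
  have "p \<le> p + t" by simp
  from segment_factorization[OF assms(1) this assms(2)] obtain \<mu> \<sigma> \<nu> where
    f: "segment \<Lambda> \<rho> p (p + t) = \<sigma>" "(\<mu>, \<sigma>) \<in> composable \<Lambda>" "(\<sigma>, \<nu>) \<in> composable \<Lambda>"
    "deg \<Lambda> \<mu> = p" "deg \<Lambda> \<sigma> = p + t - p" "\<rho> = cmp \<Lambda> \<mu> (cmp \<Lambda> \<sigma> \<nu>)" .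
  have "segment \<Lambda> \<sigma> a b = segment \<Lambda> (cmp \<Lambda> \<sigma> \<nu>) a b"
    using segment_cmp_left[OF f(3) assms(3)] assms(4) f(5) by simp
  also have "b \<le> deg \<Lambda> (cmp \<Lambda> \<sigma> \<nu>)"
    using assms(4) f(5) deg_cmp[OF f(3)] by (simp add: order_trans)
  then have "segment \<Lambda> (cmp \<Lambda> \<sigma> \<nu>) a b = segment \<Lambda> \<rho> (p + a) (p + b)"
    using segment_cmp_right[OF composable_assoc(1)[OF f(2,3)] assms(3)] f(4,6) by simp
  finally show ?thesis using f(1) by simp
qed

lemma segment_refl:
  assumes "\<rho> \<in> Mor \<Lambda>" "p \<le> q" "q \<le> deg \<Lambda> \<rho>"
  shows "segment \<Lambda> \<rho> p p = idt \<Lambda> (rng \<Lambda> (segment \<Lambda> \<rho> p q))"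
    and "segment \<Lambda> \<rho> q q = idt \<Lambda> (src \<Lambda> (segment \<Lambda> \<rho> p q))"
proof -
  have pd: "p \<le> deg \<Lambda> \<rho>" using assms by simp
  have M: "segment \<Lambda> \<rho> p p \<in> Mor \<Lambda>" "deg \<Lambda> (segment \<Lambda> \<rho> p p) = 0"
    "segment \<Lambda> \<rho> q q \<in> Mor \<Lambda>" "deg \<Lambda> (segment \<Lambda> \<rho> q q) = 0"
    using assms pd by (simp_all add: segment_Mor deg_segment)
  have "src \<Lambda> (segment \<Lambda> \<rho> p p) = rng \<Lambda> (segment \<Lambda> \<rho> p q)"
    "src \<Lambda> (segment \<Lambda> \<rho> p q) = rng \<Lambda> (segment \<Lambda> \<rho> q q)"
    using cmp_segment(1)[of \<rho> p p q] cmp_segment(1)[of \<rho> p q q] assms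
    by (auto dest: composableD(3))
  then show "segment \<Lambda> \<rho> p p = idt \<Lambda> (rng \<Lambda> (segment \<Lambda> \<rho> p q))"
    "segment \<Lambda> \<rho> q q = idt \<Lambda> (src \<Lambda> (segment \<Lambda> \<rho> p q))"
    using deg_zero_eq_idt M by metis+
qed

lemma tail_factorization:
  assumes "\<rho> \<in> Mor \<Lambda>" "deg \<Lambda> \<rho> = p + q"
  obtains \<mu> \<nu> where "segment \<Lambda> \<rho> p (p + q) = \<nu>" "(\<mu>, \<nu>) \<in> composable \<Lambda>" "deg \<Lambda> \<mu> = p"
    "deg \<Lambda> \<nu> = q" "\<rho> = cmp \<Lambda> \<mu> \<nu>" "src \<Lambda> \<nu> = src \<Lambda> \<rho>" "rng \<Lambda> \<mu> = rng \<Lambda> \<rho>"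
proof -
  from factorize[OF assms] obtain \<mu> \<nu> where
    f: "(\<mu>, \<nu>) \<in> composable \<Lambda>" "deg \<Lambda> \<mu> = p" "deg \<Lambda> \<nu> = q" "\<rho> = cmp \<Lambda> \<mu> \<nu>" .
  then show ?thesis
    using that[of \<nu> \<mu>] segment_suffix[OF f(1)] src_cmp[OF f(1)] rng_cmp[OF f(1)] by simp
qed

lemma mceI:
  assumes "(\<mu>, \<mu>') \<in> composable \<Lambda>" "(\<nu>, \<nu>') \<in> composable \<Lambda>" "cmp \<Lambda> \<mu> \<mu>' = cmp \<Lambda> \<nu> \<nu>'"
    and "deg \<Lambda> \<mu> + deg \<Lambda> \<mu>' = deg \<Lambda> \<mu> \<squnion>\<^sub>v deg \<Lambda> \<nu>"
  shows "cmp \<Lambda> \<mu> \<mu>' \<in> mce \<Lambda> \<mu> \<nu>"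
proof -
  have "cmp \<Lambda> \<mu> \<mu>' \<in> Mor \<Lambda>" "deg \<Lambda> (cmp \<Lambda> \<mu> \<mu>') = deg \<Lambda> \<mu> \<squnion>\<^sub>v deg \<Lambda> \<nu>"
    using cmp_Mor[OF assms(1)] deg_cmp[OF assms(1)] assms(4) by simp_all
  then show ?thesis
    unfolding mce_def using assms(1-3) by blast
qed

text \<open>
  Cut a common extension off at the degree \<open>d(\<mu>) \<or> d(\<nu>)\<close>; by unique factorization the part that is
  kept still begins with \<open>\<mu>\<close> and with \<open>\<nu>\<close>.
\<close>

lemma common_extension_imp_mce:
  assumes c: "(\<mu>, \<mu>') \<in> composable \<Lambda>" "(\<nu>, \<nu>') \<in> composable \<Lambda>"
    and eq: "cmp \<Lambda> \<mu> \<mu>' = cmp \<Lambda> \<nu> \<nu>'"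
  shows "mce \<Lambda> \<mu> \<nu> \<noteq> {}"
proof -
  let ?J = "deg \<Lambda> \<mu> \<squnion>\<^sub>v deg \<Lambda> \<nu>" and ?\<omega> = "cmp \<Lambda> \<mu> \<mu>'"
  have le: "deg \<Lambda> \<mu> \<le> ?J" "deg \<Lambda> \<nu> \<le> ?J" by (rule vjoin_upper)+
  have "deg \<Lambda> ?\<omega> = deg \<Lambda> \<mu> + deg \<Lambda> \<mu>'" "deg \<Lambda> ?\<omega> = deg \<Lambda> \<nu> + deg \<Lambda> \<nu>'"
    using deg_cmp c eq by metis+
  then have "deg \<Lambda> \<mu> \<le> deg \<Lambda> ?\<omega>" "deg \<Lambda> \<nu> \<le> deg \<Lambda> ?\<omega>"
    using vec_le_add by metis+
  then have "?J \<le> deg \<Lambda> ?\<omega>"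
    by (simp add: less_eq_vec_def)
  then have "deg \<Lambda> ?\<omega> = ?J + (deg \<Lambda> ?\<omega> - ?J)" by simp
  from factorize[OF cmp_Mor[OF c(1)] this] obtain \<zeta> \<eta> where
    z: "(\<zeta>, \<eta>) \<in> composable \<Lambda>" "deg \<Lambda> \<zeta> = ?J" "?\<omega> = cmp \<Lambda> \<zeta> \<eta>" .
  have prefix: "\<exists>\<alpha>'. (\<alpha>, \<alpha>') \<in> composable \<Lambda> \<and> \<zeta> = cmp \<Lambda> \<alpha> \<alpha>'"
    if a: "(\<alpha>, \<beta>) \<in> composable \<Lambda>" "?\<omega> = cmp \<Lambda> \<alpha> \<beta>" "deg \<Lambda> \<alpha> \<le> ?J" for \<alpha> \<beta>
  proof -
    have "deg \<Lambda> \<zeta> = deg \<Lambda> \<alpha> + (?J - deg \<Lambda> \<alpha>)" using z(2) a(3) by simp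
    from factorize[OF composableD(1)[OF z(1)] this] obtain \<gamma> \<delta> where
      g: "(\<gamma>, \<delta>) \<in> composable \<Lambda>" "deg \<Lambda> \<gamma> = deg \<Lambda> \<alpha>" "\<zeta> = cmp \<Lambda> \<gamma> \<delta>" .
    have d: "(\<delta>, \<eta>) \<in> composable \<Lambda>" using composable_cmp_leftD[OF g(1)] z(1) g(3) by simp
    have "cmp \<Lambda> \<gamma> (cmp \<Lambda> \<delta> \<eta>) = cmp \<Lambda> \<alpha> \<beta>"
      using cmp_assoc[OF g(1) d] g(3) z(3) a(2) by simp
    then have "\<gamma> = \<alpha>"
      using factorization_cancel(1)[OF composable_assoc(1)[OF g(1) d] a(1)] g(2) by blast
    then show ?thesis using g by blast
  qed
  have "\<zeta> \<in> mce \<Lambda> \<mu> \<nu>"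
    using prefix[OF c(1) refl le(1)] prefix[OF c(2) eq le(2)] composableD(1)[OF z(1)] z(2)
    unfolding mce_def by blast
  then show ?thesis by blast
qed

lemma no_sources_path:
  assumes "no_sources \<Lambda>" "v \<in> Obj \<Lambda>"
  obtains \<rho> where "\<rho> \<in> Mor \<Lambda>" "rng \<Lambda> \<rho> = v" "deg \<Lambda> \<rho> = n"
  using assms unfolding no_sources_def is_source_def paths_into_def by blast

end


section \<open>Topology of the path spaces of fixed degree\<close>


text \<open>
  Openness is local, and each chart is open onto an open set.
\<close>

lemma local_homeomorphism_open_map:
  assumes f: "local_homeomorphism X Y f" and U: "openin X U"
  shows "openin Y (f ` U)"
proof (subst openin_subopen, intro ballI)
  fix y assume "y \<in> f ` U"
  then obtain x where x: "x \<in> U" "y = f x" by blast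
  then have "x \<in> topspace X" using U openin_subset by blast
  then obtain O' where O': "openin X O'" "x \<in> O'" "openin Y (f ` O')"
    "homeomorphic_map (subtopology X O') (subtopology Y (f ` O')) f"
    using f unfolding local_homeomorphism_def by blast
  have "openin (subtopology X O') (U \<inter> O')"
    using U by (simp add: openin_subtopology_Int)
  then have "openin (subtopology Y (f ` O')) (f ` (U \<inter> O'))"
    using homeomorphic_imp_open_map[OF O'(4)] unfolding open_map_def by blast
  then have "openin Y (f ` (U \<inter> O'))"
    using O'(3) openin_trans_full by blast
  then show "\<exists>T. openin Y T \<and> y \<in> T \<and> T \<subseteq> f ` U"
    using x O'(2) by blast
qed

lemma local_homeomorphism_injective_neighbourhood:
  assumes "local_homeomorphism X Y f" "openin X U" "x \<in> U"
  obtains N where "openin X N" "x \<in> N" "N \<subseteq> U" "inj_on f N"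
proof -
  have "x \<in> topspace X" using assms openin_subset by blast
  then obtain O' where O': "openin X O'" "x \<in> O'"
    "homeomorphic_map (subtopology X O') (subtopology Y (f ` O')) f"
    using assms(1) unfolding local_homeomorphism_def by blast
  have "topspace (subtopology X O') = O'"
    using O'(1) openin_subset by fastforce
  then have "inj_on f O'"
    using homeomorphic_imp_injective_map[OF O'(3)] by simp
  then show ?thesis
    using that[of "U \<inter> O'"] assms O' by (auto intro: inj_on_subset)
qed

lemma local_homeomorphism_injective_imp_homeomorphic_map:
  assumes f: "local_homeomorphism X Y f" "continuous_map X Y f" and U: "openin X U" "inj_on f U"
  shows "homeomorphic_map (subtopology X U) (subtopology Y (f ` U)) f"
proof -
  have UX: "U \<subseteq> topspace X" using U openin_subset by blast
  have fU: "openin Y (f ` U)" using local_homeomorphism_open_map f U by blast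
  show ?thesis
  proof (rule bijective_open_imp_homeomorphic_map)
    show "continuous_map (subtopology X U) (subtopology Y (f ` U)) f"
      using f(2) by (auto simp: continuous_map_in_subtopology continuous_map_from_subtopology)
    show "open_map (subtopology X U) (subtopology Y (f ` U)) f"
      unfolding open_map_def
    proof (intro allI impI)
      fix S assume "openin (subtopology X U) S"
      then have "openin X S" "S \<subseteq> U" 
        using U(1) openin_open_subtopology by blast+
      then show "openin (subtopology Y (f ` U)) (f ` S)"
        using local_homeomorphism_open_map[OF f(1)] fU openin_open_subtopology by (metis image_mono)
    qed
    show "f ` topspace (subtopology X U) = topspace (subtopology Y (f ` U))"
      using UX openin_subset[OF fU] by (auto simp: Int_absorb1)
    show "inj_on f (topspace (subtopology X U))"
      using U(2) UX by (auto intro: inj_on_subset)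
  qed
qed

lemma compact_neighbourhood:
  assumes "locally_compact_space X" "Hausdorff_space X" "openin X U" "x \<in> U"
  obtains V K where "openin X V" "compactin X K" "x \<in> V" "V \<subseteq> K" "K \<subseteq> U"
proof -
  have "neighbourhood_base_of (compactin X) X"
    using locally_compact_space_neighbourhood_base assms(1,2) by blast
  then show ?thesis
    using assms(3,4) that unfolding neighbourhood_base_of by meson
qed

text \<open>
  In the compact product, the conditions that the first \<open>l\<close> bonding equations hold cut out a
  decreasing sequence of closed sets. They are nonempty since a point of \<open>X l\<close> can be pushed down to all
  earlier coordinates, so they have a common point.
\<close>

lemma inverse_limit_nonempty:
  fixes X :: "nat \<Rightarrow> 'a topology"
  assumes X: "\<And>j. compact_space (X j)" "\<And>j. Hausdorff_space (X j)" "\<And>j. topspace (X j) \<noteq> {}"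
    and f: "\<And>j. continuous_map (X (Suc j)) (X j) (f j)"
  obtains \<kappa> where "\<forall>j. \<kappa> j \<in> topspace (X j)" "\<forall>j. f j (\<kappa> (Suc j)) = \<kappa> j"
proof -
  let ?P = "product_topology X UNIV"
  define C where "C l = {g \<in> topspace ?P. \<forall>j<l. f j (g (Suc j)) = g j}" for l
  have P: "compact_space ?P"
    using X(1) by (simp add: compact_space_product_topology)
  have closed: "closedin ?P (C l)" for l
  proof (induction l)
    case 0
    show ?case by (simp add: C_def del: topspace_product_topology)
  next
    case (Suc l)
    have "continuous_map ?P (X l) (\<lambda>g. f l (g (Suc l)))"
      using continuous_map_compose[OF continuous_map_product_projection[of "Suc l" UNIV X] f[of l]]
      by (simp add: o_def)
    moreover have "continuous_map ?P (X l) (\<lambda>g. g l)"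
      by (rule continuous_map_product_projection) simp
    ultimately have cl: "closedin ?P {g \<in> topspace ?P. f l (g (Suc l)) = g l}"
      by (rule closedin_continuous_maps_eq[OF X(2)])
    have C: "C (Suc l) = C l \<inter> {g \<in> topspace ?P. f l (g (Suc l)) = g l}"
      unfolding C_def by (auto simp: less_Suc_eq)
    show ?case
      unfolding C by (rule closedin_Int[OF Suc.IH cl])
  qed
  have extend: "\<exists>g\<in>C l. g l = z" if "z \<in> topspace (X l)" for l z
    using that
  proof (induction l arbitrary: z)
    case 0
    define w where "w j = (SOME z. z \<in> topspace (X j))" for j
    have "w j \<in> topspace (X j)" for j
      using X(3) by (simp add: w_def some_in_eq)
    then have "w(0 := z) \<in> C 0" using 0 by (simp add: C_def PiE_iff)
    then show ?case by (metis fun_upd_same)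
  next
    case (Suc l)
    have "f l z \<in> topspace (X l)"
      using f Suc.prems by (simp add: continuous_map_def Pi_iff)
    from Suc.IH[OF this] obtain g where g: "g \<in> C l" "g l = f l z" by blast
    then have "g(Suc l := z) \<in> C (Suc l)"
      using Suc.prems by (auto simp: C_def less_Suc_eq PiE_iff)
    then show ?case by (metis fun_upd_same)
  qed
  have ne: "C l \<noteq> {}" for l using extend X(3) by blast
  have "decseq C" unfolding decseq_def C_def by auto
  from compact_space_imp_nest[OF P closed ne this] have "(\<Inter>l. C l) \<noteq> {}" .
  then obtain \<kappa> where "\<forall>l. \<kappa> \<in> C l" by blast
  then have "\<forall>j. \<kappa> j \<in> topspace (X j)" "\<forall>j. f j (\<kappa> (Suc j)) = \<kappa> j"
    unfolding C_def by (auto simp: PiE_iff)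
  then show ?thesis by (rule that)
qed

definition paths_of_degree :: "('v, 'a, 'k::finite) kgraph \<Rightarrow> nat ^ 'k \<Rightarrow> 'a set" where
  "paths_of_degree \<Lambda> n = {\<rho> \<in> Mor \<Lambda>. deg \<Lambda> \<rho> = n}"

context topological_kgraph
begin


lemma openin_paths_of_degree: "openin (mtop \<Lambda>) (paths_of_degree \<Lambda> n)"
  using openin_continuous_map_preimage[OF continuous_deg, of "{n}"]
  by (simp add: paths_of_degree_def)

lemma openin_paths_into: "openin (otop \<Lambda>) V \<Longrightarrow> openin (mtop \<Lambda>) (paths_into \<Lambda> V)"
  using openin_continuous_map_preimage[OF continuous_rng] by (simp add: paths_into_def)

lemma openin_src_image: "openin (mtop \<Lambda>) U \<Longrightarrow> openin (otop \<Lambda>) (src \<Lambda> ` U)"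
  using local_homeomorphism_open_map[OF local_homeomorphism_src] .

lemma openin_downstream:
  "openin (otop \<Lambda>) V \<Longrightarrow> openin (otop \<Lambda>) (src \<Lambda> ` (paths_into \<Lambda> V \<inter> paths_of_degree \<Lambda> n))"
  by (intro openin_src_image openin_Int openin_paths_into openin_paths_of_degree)

lemma downstream_nonempty:
  assumes "no_sources \<Lambda>" "openin (otop \<Lambda>) V" "V \<noteq> {}"
  shows "src \<Lambda> ` (paths_into \<Lambda> V \<inter> paths_of_degree \<Lambda> n) \<noteq> {}"
proof -
  obtain v where v: "v \<in> V" "v \<in> Obj \<Lambda>" using assms openin_subset by blast
  then show ?thesis
    using no_sources_path[OF assms(1) v(2), of n] by (auto simp: paths_into_def paths_of_degree_def)
qed

lemma set_cmp_eq_image: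
  assumes "X \<subseteq> Mor \<Lambda>" "Y \<subseteq> Mor \<Lambda>"
  shows "set_cmp \<Lambda> X Y = (\<lambda>(\<rho>, \<mu>). cmp \<Lambda> \<rho> \<mu>) ` (composable \<Lambda> \<inter> X \<times> Y)"
  using assms by (force simp: set_cmp_def composable_def image_iff)

text \<open>
  The only use of the openness of composition: it makes factorization continuous.
\<close>

lemma openin_set_cmp:
  assumes "openin (mtop \<Lambda>) X" "openin (mtop \<Lambda>) Y"
  shows "openin (mtop \<Lambda>) (set_cmp \<Lambda> X Y)"
proof -
  have "openin (prod_topology (mtop \<Lambda>) (mtop \<Lambda>)) (X \<times> Y)"
    using assms by (simp add: openin_prod_Times_iff)
  then have "openin (subtopology (prod_topology (mtop \<Lambda>) (mtop \<Lambda>)) (composable \<Lambda>)) (composable \<Lambda> \<inter> X \<times> Y)"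
    by (simp add: openin_subtopology_Int2)
  then show ?thesis
    using open_cmp set_cmp_eq_image assms openin_subset unfolding open_map_def by metis
qed

lemma set_cmp_iff:
  assumes "X \<subseteq> Mor \<Lambda>" "Y \<subseteq> Mor \<Lambda>"
  shows "\<rho> \<in> set_cmp \<Lambda> X Y \<longleftrightarrow> (\<exists>\<mu>\<in>X. \<exists>\<nu>\<in>Y. (\<mu>, \<nu>) \<in> composable \<Lambda> \<and> \<rho> = cmp \<Lambda> \<mu> \<nu>)"
  using assms by (auto simp: set_cmp_def composable_def)

text \<open>
  On \<open>\<Lambda>\<^sup>t\<close>, the paths whose \<open>(p, q)\<close>-segment lies in \<open>U\<close> form the product
  \<open>\<Lambda>\<^sup>p (U \<inter> \<Lambda>\<^bsup>q - p\<^esup>) \<Lambda>\<^bsup>t - q\<^esup>\<close>, and products of open sets are open.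
\<close>

lemma continuous_segment:
  assumes pq: "p \<le> q" and qt: "q \<le> t"
  shows "continuous_map (subtopology (mtop \<Lambda>) (paths_of_degree \<Lambda> t)) (mtop \<Lambda>) (\<lambda>\<rho>. segment \<Lambda> \<rho> p q)"
    (is "continuous_map ?X _ _")
  unfolding continuous_map_def
proof (intro conjI funcsetI allI impI)
  have tX: "topspace ?X = paths_of_degree \<Lambda> t"
    using openin_subset[OF openin_paths_of_degree] by auto
  fix \<rho> assume "\<rho> \<in> topspace ?X"
  then show "segment \<Lambda> \<rho> p q \<in> Mor \<Lambda>"
    unfolding tX using assms segment_Mor by (simp add: paths_of_degree_def)
next
  have tX: "topspace ?X = paths_of_degree \<Lambda> t"
    using openin_subset[OF openin_paths_of_degree] by auto
  fix U assume U: "openin (mtop \<Lambda>) U"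
  define M where "M = set_cmp \<Lambda> (U \<inter> paths_of_degree \<Lambda> (q - p)) (paths_of_degree \<Lambda> (t - q))"
  define S where "S = set_cmp \<Lambda> (paths_of_degree \<Lambda> p) M"
  have M: "openin (mtop \<Lambda>) M"
    unfolding M_def using U by (intro openin_set_cmp openin_Int openin_paths_of_degree)
  have S: "openin (mtop \<Lambda>) S"
    unfolding S_def using M by (intro openin_set_cmp openin_paths_of_degree)
  have sub: "U \<inter> paths_of_degree \<Lambda> (q - p) \<subseteq> Mor \<Lambda>" "paths_of_degree \<Lambda> n \<subseteq> Mor \<Lambda>" for n
    by (auto simp: paths_of_degree_def)
  have "{\<rho> \<in> topspace ?X. segment \<Lambda> \<rho> p q \<in> U} = S"
    unfolding tX
  proof (intro equalityI subsetI)
    fix \<rho> assume "\<rho> \<in> {\<rho> \<in> paths_of_degree \<Lambda> t. segment \<Lambda> \<rho> p q \<in> U}"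
    then have r: "\<rho> \<in> Mor \<Lambda>" "deg \<Lambda> \<rho> = t" "segment \<Lambda> \<rho> p q \<in> U"
      by (auto simp: paths_of_degree_def)
    from segment_factorization[OF r(1) pq] r(2) qt obtain \<mu> \<sigma> \<nu> where
      f: "segment \<Lambda> \<rho> p q = \<sigma>" "(\<mu>, \<sigma>) \<in> composable \<Lambda>" "(\<sigma>, \<nu>) \<in> composable \<Lambda>"
      "deg \<Lambda> \<mu> = p" "deg \<Lambda> \<sigma> = q - p" "deg \<Lambda> \<nu> = t - q" "\<rho> = cmp \<Lambda> \<mu> (cmp \<Lambda> \<sigma> \<nu>)"
      by metis
    have "\<sigma> \<in> U \<inter> paths_of_degree \<Lambda> (q - p)" "\<nu> \<in> paths_of_degree \<Lambda> (t - q)"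
      using f(1,5,6) r(3) composableD(1,2)[OF f(3)] by (simp_all add: paths_of_degree_def)
    then have "cmp \<Lambda> \<sigma> \<nu> \<in> M"
      unfolding M_def set_cmp_iff[OF sub] using f(3) by blast
    then show "\<rho> \<in> S"
      unfolding S_def set_cmp_iff[OF sub(2) openin_subset[OF M]]
      using f(2-4,7) \<open>cmp \<Lambda> \<sigma> \<nu> \<in> M\<close> composableD(1)[OF f(2)] composable_assoc(1)[OF f(2,3)]
      by (auto simp: paths_of_degree_def)
  next
    fix \<rho> assume "\<rho> \<in> S"
    then obtain \<mu> \<xi> where 1: "(\<mu>, \<xi>) \<in> composable \<Lambda>" "\<xi> \<in> M" "deg \<Lambda> \<mu> = p" "\<rho> = cmp \<Lambda> \<mu> \<xi>"
      unfolding S_def set_cmp_iff[OF sub(2) openin_subset[OF M]] by (auto simp: paths_of_degree_def)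
    then obtain \<sigma> \<nu> where 2: "(\<sigma>, \<nu>) \<in> composable \<Lambda>" "\<sigma> \<in> U" "deg \<Lambda> \<sigma> = q - p"
        "deg \<Lambda> \<nu> = t - q" "\<xi> = cmp \<Lambda> \<sigma> \<nu>"
      unfolding M_def set_cmp_iff[OF sub] by (auto simp: paths_of_degree_def)
    have c: "(\<mu>, \<sigma>) \<in> composable \<Lambda>"
      using 1 2 composable_cmp_rightD by blast
    have "deg \<Lambda> \<rho> = t"
      using 1 2 deg_cmp[OF 1(1)] deg_cmp[OF 2(1)] pq qt by (simp add: vec_diff_add_diff)
    moreover have "segment \<Lambda> \<rho> p q = \<sigma>"
      unfolding 1(4) 2(5) using 1 2 c pq by (intro segment_cmp) auto
    ultimately show "\<rho> \<in> {\<rho> \<in> paths_of_degree \<Lambda> t. segment \<Lambda> \<rho> p q \<in> U}"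
      using cmp_Mor[OF 1(1)] 1 2 by (simp add: paths_of_degree_def)
  qed
  then show "openin ?X {\<rho> \<in> topspace ?X. segment \<Lambda> \<rho> p q \<in> U}"
    using S openin_open_subtopology[OF openin_paths_of_degree] tX by blast
qed

lemma openin_segment_preimage:
  assumes "p \<le> q" "q \<le> t" "openin (mtop \<Lambda>) U"
  shows "openin (mtop \<Lambda>) {\<rho> \<in> paths_of_degree \<Lambda> t. segment \<Lambda> \<rho> p q \<in> U}"
proof -
  have tX: "topspace (subtopology (mtop \<Lambda>) (paths_of_degree \<Lambda> t)) = paths_of_degree \<Lambda> t"
    using openin_subset[OF openin_paths_of_degree] by auto
  show ?thesis
    using openin_continuous_map_preimage[OF continuous_segment[OF assms(1,2)] assms(3)]
    unfolding tX openin_open_subtopology[OF openin_paths_of_degree] by blast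
qed

lemma openin_segments_differ:
  assumes "p \<le> q" "q \<le> t" "p' \<le> q'" "q' \<le> t"
  shows "openin (mtop \<Lambda>) {\<rho> \<in> paths_of_degree \<Lambda> t. segment \<Lambda> \<rho> p q \<noteq> segment \<Lambda> \<rho> p' q'}"
proof -
  let ?X = "subtopology (mtop \<Lambda>) (paths_of_degree \<Lambda> t)"
  have tX: "topspace ?X = paths_of_degree \<Lambda> t"
    using openin_subset[OF openin_paths_of_degree] by auto
  have "closedin ?X {\<rho> \<in> topspace ?X. segment \<Lambda> \<rho> p q = segment \<Lambda> \<rho> p' q'}"
    using assms by (intro closedin_continuous_maps_eq[OF Hausdorff_mtop] continuous_segment)
  then have "openin ?X (topspace ?X - {\<rho> \<in> topspace ?X. segment \<Lambda> \<rho> p q = segment \<Lambda> \<rho> p' q'})"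
    by blast
  also have "topspace ?X - {\<rho> \<in> topspace ?X. segment \<Lambda> \<rho> p q = segment \<Lambda> \<rho> p' q'} =
    {\<rho> \<in> paths_of_degree \<Lambda> t. segment \<Lambda> \<rho> p q \<noteq> segment \<Lambda> \<rho> p' q'}"
    unfolding tX by blast
  finally show ?thesis
    unfolding openin_open_subtopology[OF openin_paths_of_degree] by blast
qed

lemma compactin_segment_image:
  assumes "compactin (mtop \<Lambda>) K" "K \<subseteq> paths_of_degree \<Lambda> t" "p \<le> q" "q \<le> t"
  shows "compactin (mtop \<Lambda>) ((\<lambda>\<rho>. segment \<Lambda> \<rho> p q) ` K)"
  using assms by (intro image_compactin[OF _ continuous_segment]) (auto simp: compactin_subtopology)

text \<open>
  Given \<open>\<alpha>\<beta>\<close> in \<open>N\<close>, a path \<open>\<nu>\<close> close to \<open>\<beta>\<close> has its range close to \<open>s(\<alpha>)\<close>. As \<open>s\<close> is open, that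
  range is the source of some \<open>\<mu>\<close> close to \<open>\<alpha>\<close>, and \<open>\<mu>\<nu>\<close> lies in \<open>N\<close> by continuity of composition.
  There is no such statement for initial segments, since \<open>r\<close> need not be open.
\<close>

lemma openin_tails:
  assumes N: "openin (mtop \<Lambda>) N" and deg: "N \<subseteq> paths_of_degree \<Lambda> (p + q)"
  shows "openin (mtop \<Lambda>) ((\<lambda>\<rho>. segment \<Lambda> \<rho> p (p + q)) ` N)"
proof (subst openin_subopen, intro ballI)
  fix \<beta> assume "\<beta> \<in> (\<lambda>\<rho>. segment \<Lambda> \<rho> p (p + q)) ` N"
  then obtain \<rho> where r: "\<rho> \<in> N" "\<beta> = segment \<Lambda> \<rho> p (p + q)" by blast
  let ?P = "prod_topology (mtop \<Lambda>) (mtop \<Lambda>)" and ?c = "\<lambda>(\<mu>, \<nu>). cmp \<Lambda> \<mu> \<nu>"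
  have r': "\<rho> \<in> Mor \<Lambda>" "deg \<Lambda> \<rho> = p + q" using r deg by (auto simp: paths_of_degree_def)
  have tail: "segment \<Lambda> (cmp \<Lambda> \<mu> \<nu>) p (p + q) = \<nu>"
    if "(\<mu>, \<nu>) \<in> composable \<Lambda>" "deg \<Lambda> \<mu> = p" "deg \<Lambda> \<nu> = q" for \<mu> \<nu>
    using segment_suffix[OF that(1)] that(2,3) by simp
  obtain \<alpha> \<beta>' where f: "(\<alpha>, \<beta>') \<in> composable \<Lambda>" "deg \<Lambda> \<alpha> = p" "deg \<Lambda> \<beta>' = q" "\<rho> = cmp \<Lambda> \<alpha> \<beta>'"
    using factorize[OF r'] .
  have b: "\<beta>' = \<beta>" unfolding r(2) f(4) by (rule tail[OF f(1-3), symmetric])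
  have ts: "topspace (subtopology ?P (composable \<Lambda>)) = composable \<Lambda>"
    by (auto simp: composable_def)
  have "openin (subtopology ?P (composable \<Lambda>)) {z \<in> composable \<Lambda>. ?c z \<in> N}"
    using openin_continuous_map_preimage[OF continuous_cmp N] unfolding ts .
  then obtain W where W: "openin ?P W" "{z \<in> composable \<Lambda>. ?c z \<in> N} = W \<inter> composable \<Lambda>"
    unfolding openin_subtopology by blast
  have W_iff: "z \<in> W \<longleftrightarrow> ?c z \<in> N" if "z \<in> composable \<Lambda>" for z
    using that W(2) by (metis (no_types, lifting) IntE IntI mem_Collect_eq)
  have "(\<alpha>, \<beta>) \<in> W" using W_iff[OF f(1)] f(4) r(1) b by simp
  then obtain A B where AB: "openin (mtop \<Lambda>) A" "openin (mtop \<Lambda>) B" "\<alpha> \<in> A" "\<beta> \<in> B" "A \<times> B \<subseteq> W"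
    using W(1)[unfolded openin_prod_topology_alt, rule_format, of \<alpha> \<beta>] by blast
  define A' where "A' = A \<inter> paths_of_degree \<Lambda> p"
  define T where "T = B \<inter> paths_of_degree \<Lambda> q \<inter> paths_into \<Lambda> (src \<Lambda> ` A')"
  have "openin (mtop \<Lambda>) A'"
    unfolding A'_def using AB by (intro openin_Int openin_paths_of_degree)
  then have T: "openin (mtop \<Lambda>) T"
    unfolding T_def using AB by (intro openin_Int openin_paths_of_degree openin_paths_into openin_src_image)
  have "\<alpha> \<in> A'"
    using f(2) AB(3) composableD[OF f(1)] by (simp add: A'_def paths_of_degree_def)
  then have "\<beta> \<in> T"
    using f(3) AB(4) b composableD[OF f(1)]
    by (auto simp: T_def paths_of_degree_def paths_into_def intro!: image_eqI[of _ _ \<alpha>])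
  moreover have "T \<subseteq> (\<lambda>\<rho>. segment \<Lambda> \<rho> p (p + q)) ` N"
  proof
    fix \<nu> assume "\<nu> \<in> T"
    then obtain \<mu> where m: "\<mu> \<in> A" "\<mu> \<in> Mor \<Lambda>" "deg \<Lambda> \<mu> = p" "src \<Lambda> \<mu> = rng \<Lambda> \<nu>" "\<nu> \<in> B" "\<nu> \<in> Mor \<Lambda>" "deg \<Lambda> \<nu> = q"
      by (auto simp: T_def A'_def paths_of_degree_def paths_into_def)
    then have c: "(\<mu>, \<nu>) \<in> composable \<Lambda>" by (simp add: composable_def)
    moreover have "(\<mu>, \<nu>) \<in> W" using AB(5) m(1,5) by blast
    ultimately have "cmp \<Lambda> \<mu> \<nu> \<in> N" using W_iff by auto
    then show "\<nu> \<in> (\<lambda>\<rho>. segment \<Lambda> \<rho> p (p + q)) ` N"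
      using tail[OF c m(3,7)] by force
  qed
  ultimately show "\<exists>T. openin (mtop \<Lambda>) T \<and> \<beta> \<in> T \<and> T \<subseteq> (\<lambda>\<rho>. segment \<Lambda> \<rho> p (p + q)) ` N"
    using T by blast
qed

end


section \<open>Periodicity on an open set of vertices\<close>


text \<open>
  The assertion that \<open>\<sigma>\<^sup>m = \<sigma>\<^sup>n\<close> on all paths with range in \<open>V\<close>, expressed through finite paths. The
  surplus \<open>q\<close> of the degree over \<open>m \<or> n\<close> replaces the truncated differences in (B).
\<close>

definition periodic_on :: "('v, 'a, 'k::finite) kgraph \<Rightarrow> 'v set \<Rightarrow> nat ^ 'k \<Rightarrow> nat ^ 'k \<Rightarrow> bool" where
  "periodic_on \<Lambda> V m n \<longleftrightarrow> (\<forall>\<rho>\<in>paths_into \<Lambda> V. \<forall>q. deg \<Lambda> \<rho> = (m \<squnion>\<^sub>v n) + q \<longrightarrow>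
     segment \<Lambda> \<rho> m (m + q) = segment \<Lambda> \<rho> n (n + q))"

lemma periodic_on_sym: "periodic_on \<Lambda> V m n \<Longrightarrow> periodic_on \<Lambda> V n m"
  unfolding periodic_on_def vjoin_commute[of n m] by fastforce

lemma condition_B_iff:
  "condition_B \<Lambda> \<longleftrightarrow>
     (\<forall>V m n. openin (otop \<Lambda>) V \<and> V \<noteq> {} \<and> m \<noteq> n \<longrightarrow> \<not> periodic_on \<Lambda> V m n)"
proof -
  have cancel: "l + (k + q) - k = l + q" for l k q :: "nat ^ 'c"
    by (metis add.left_commute add_diff_cancel_left')
  have "(\<exists>\<rho>\<in>paths_into \<Lambda> V. m \<squnion>\<^sub>v n \<le> deg \<Lambda> \<rho> \<and>
      segment \<Lambda> \<rho> m (m + deg \<Lambda> \<rho> - (m \<squnion>\<^sub>v n)) \<noteq> segment \<Lambda> \<rho> n (n + deg \<Lambda> \<rho> - (m \<squnion>\<^sub>v n)))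
    \<longleftrightarrow> \<not> periodic_on \<Lambda> V m n" for V m n
    unfolding periodic_on_def le_iff_add by (auto simp: cancel) (metis cancel)+
  then show ?thesis
    unfolding condition_B_def by presburger
qed

context topological_kgraph
begin


text \<open>
  Prefix a path by one of degree \<open>l\<close>: the segments at \<open>l + m\<close> and \<open>l + n\<close> of the longer path are the
  segments at \<open>m\<close> and \<open>n\<close> of the given one.
\<close>

lemma periodic_on_reduce:
  assumes "periodic_on \<Lambda> V (l + m) (l + n)"
  shows "periodic_on \<Lambda> (src \<Lambda> ` (paths_into \<Lambda> V \<inter> paths_of_degree \<Lambda> l)) m n"
  unfolding periodic_on_def
proof (intro ballI allI impI)
  fix \<rho> q
  assume "\<rho> \<in> paths_into \<Lambda> (src \<Lambda> ` (paths_into \<Lambda> V \<inter> paths_of_degree \<Lambda> l))"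
    and d: "deg \<Lambda> \<rho> = (m \<squnion>\<^sub>v n) + q"
  then obtain \<mu> where \<mu>: "\<mu> \<in> paths_into \<Lambda> V" "deg \<Lambda> \<mu> = l" "(\<mu>, \<rho>) \<in> composable \<Lambda>"
    by (auto simp: paths_into_def paths_of_degree_def composable_def)
  have "cmp \<Lambda> \<mu> \<rho> \<in> paths_into \<Lambda> V"
    using \<mu> cmp_Mor rng_cmp by (simp add: paths_into_def)
  moreover have "deg \<Lambda> (cmp \<Lambda> \<mu> \<rho>) = ((l + m) \<squnion>\<^sub>v (l + n)) + q"
    using deg_cmp[OF \<mu>(3)] \<mu>(2) d vjoin_add[of m l n] by (simp add: add.commute add.left_commute)
  ultimately have "segment \<Lambda> (cmp \<Lambda> \<mu> \<rho>) (l + m) (l + m + q) = segment \<Lambda> (cmp \<Lambda> \<mu> \<rho>) (l + n) (l + n + q)"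
    using assms unfolding periodic_on_def by blast
  moreover have "m + q \<le> deg \<Lambda> \<rho>" "n + q \<le> deg \<Lambda> \<rho>"
    using d vjoin_upper[of m n] vjoin_upper[of n m] by (simp_all add: add_right_mono)
  ultimately show "segment \<Lambda> \<rho> m (m + q) = segment \<Lambda> \<rho> n (n + q)"
    using segment_cmp_right[OF \<mu>(3), of m "m + q"] segment_cmp_right[OF \<mu>(3), of n "n + q"] \<mu>(2)
    by (simp add: add.assoc)
qed

text \<open>
  If \<open>\<sigma>\<^sup>m\<close> and \<open>\<sigma>\<^sup>n\<close> agree on \<open>\<mu>\<rho>\<close>, then so do \<open>\<sigma>\<^bsup>m + l\<^esup>\<close> and \<open>\<sigma>\<^bsup>n + l\<^esup>\<close> for \<open>l = d(\<mu>)\<close>, and these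
  are \<open>\<sigma>\<^sup>m\<close> and \<open>\<sigma>\<^sup>n\<close> of \<open>\<rho>\<close>. So periodicity persists along paths, and the set of vertices may be
  enlarged to one that is closed under following paths from range to source.
\<close>

lemma periodic_on_downstream:
  assumes "periodic_on \<Lambda> V m n"
  shows "periodic_on \<Lambda> (src \<Lambda> ` paths_into \<Lambda> V) m n"
  unfolding periodic_on_def
proof (intro ballI allI impI)
  fix \<rho> q
  assume "\<rho> \<in> paths_into \<Lambda> (src \<Lambda> ` paths_into \<Lambda> V)" and d: "deg \<Lambda> \<rho> = (m \<squnion>\<^sub>v n) + q"
  then obtain \<mu> where \<mu>: "\<mu> \<in> paths_into \<Lambda> V" "(\<mu>, \<rho>) \<in> composable \<Lambda>"
    by (auto simp: paths_into_def composable_def)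
  let ?l = "deg \<Lambda> \<mu>" and ?\<omega> = "cmp \<Lambda> \<mu> \<rho>"
  have M: "?\<omega> \<in> Mor \<Lambda>" "?\<omega> \<in> paths_into \<Lambda> V"
    using \<mu> cmp_Mor rng_cmp by (simp_all add: paths_into_def)
  have D: "deg \<Lambda> ?\<omega> = (m \<squnion>\<^sub>v n) + (?l + q)"
    using deg_cmp[OF \<mu>(2)] d by (simp add: add.left_commute)
  have read: "segment \<Lambda> (segment \<Lambda> ?\<omega> j (j + (?l + q))) ?l (?l + q) = segment \<Lambda> \<rho> j (j + q)"
    if "j \<le> m \<squnion>\<^sub>v n" for j
  proof -
    have "j + (?l + q) \<le> deg \<Lambda> ?\<omega>" "j + q \<le> deg \<Lambda> \<rho>"
      unfolding D d using that by (auto intro: add_right_mono)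
    then show ?thesis
      using segment_segment[OF M(1), of j "?l + q" ?l "?l + q"]
        segment_cmp_right[OF \<mu>(2), of j "j + q"] by (simp add: add.commute add.left_commute)
  qed
  have "segment \<Lambda> ?\<omega> m (m + (?l + q)) = segment \<Lambda> ?\<omega> n (n + (?l + q))"
    using assms M(2) D unfolding periodic_on_def by blast
  then show "segment \<Lambda> \<rho> m (m + q) = segment \<Lambda> \<rho> n (n + q)"
    using read[OF vjoin_upper(1)] read[OF vjoin_upper(2)] by metis
qed

lemma not_condition_B_imp_periodic:
  assumes "no_sources \<Lambda>" "\<not> condition_B \<Lambda>"
  obtains W m n where "openin (otop \<Lambda>) W" "W \<noteq> {}" "m \<noteq> n" "m \<squnion>\<^sub>v n = m + n" "periodic_on \<Lambda> W m n"
proof -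
  obtain V m n where V: "openin (otop \<Lambda>) V" "V \<noteq> {}" "m \<noteq> n" "periodic_on \<Lambda> V m n"
    using assms(2) condition_B_iff by blast
  \<comment> \<open>The common part of \<open>m\<close> and \<open>n\<close> can be shifted away.\<close>
  define l :: "nat ^ 'k" where "l = (\<chi> i. min (m $ i) (n $ i))"
  have mn: "l + (m - l) = m" "l + (n - l) = n"
    by (simp_all add: l_def vec_eq_iff)
  have ne: "m - l \<noteq> n - l"
  proof
    assume "m - l = n - l"
    with mn have "m = n" by metis
    then show False using V(3) by simp
  qed
  have J: "(m - l) \<squnion>\<^sub>v (n - l) = (m - l) + (n - l)"
    by (simp add: l_def vec_eq_iff max_def min_def)
  have P: "periodic_on \<Lambda> (src \<Lambda> ` (paths_into \<Lambda> V \<inter> paths_of_degree \<Lambda> l)) (m - l) (n - l)"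
    using periodic_on_reduce[of V l "m - l" "n - l"] V(4) unfolding mn .
  show ?thesis
    by (rule that[OF openin_downstream[OF V(1)] downstream_nonempty[OF assms(1) V(1,2)] ne J P])
qed

text \<open>
  How the path \<open>\<mu>\<beta> \<cdot> \<tau> \<cdot> \<tau>\<^sub>1\<tau>\<^sub>2\<close> is seen from \<open>d(\<mu>)\<close> on, with the last factor left out.
\<close>

lemma segment_extension:
  assumes c: "(\<mu>, \<beta>) \<in> composable \<Lambda>" "(\<beta>, \<tau>) \<in> composable \<Lambda>" "(\<tau>, \<tau>\<^sub>1) \<in> composable \<Lambda>"
      "(\<tau>\<^sub>1, \<tau>\<^sub>2) \<in> composable \<Lambda>"
  shows "segment \<Lambda> (cmp \<Lambda> (cmp \<Lambda> (cmp \<Lambda> \<mu> \<beta>) \<tau>) (cmp \<Lambda> \<tau>\<^sub>1 \<tau>\<^sub>2)) (deg \<Lambda> \<mu>)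
    (deg \<Lambda> \<mu> + (deg \<Lambda> \<beta> + deg \<Lambda> \<tau> + deg \<Lambda> \<tau>\<^sub>1)) = cmp \<Lambda> (cmp \<Lambda> \<beta> \<tau>) \<tau>\<^sub>1"
proof -
  have 1: "(\<mu>, cmp \<Lambda> \<beta> \<tau>) \<in> composable \<Lambda>" using composable_assoc c by blast
  have 2: "(cmp \<Lambda> \<beta> \<tau>, \<tau>\<^sub>1) \<in> composable \<Lambda>" using composable_assoc c by blast
  have 3: "(cmp \<Lambda> (cmp \<Lambda> \<beta> \<tau>) \<tau>\<^sub>1, \<tau>\<^sub>2) \<in> composable \<Lambda>" "(\<mu>, cmp \<Lambda> (cmp \<Lambda> \<beta> \<tau>) \<tau>\<^sub>1) \<in> composable \<Lambda>"
      "(cmp \<Lambda> \<beta> \<tau>, cmp \<Lambda> \<tau>\<^sub>1 \<tau>\<^sub>2) \<in> composable \<Lambda>"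
    using composable_assoc 1 2 c(4) by blast+
  have "cmp \<Lambda> (cmp \<Lambda> (cmp \<Lambda> \<mu> \<beta>) \<tau>) (cmp \<Lambda> \<tau>\<^sub>1 \<tau>\<^sub>2) =
      cmp \<Lambda> \<mu> (cmp \<Lambda> (cmp \<Lambda> (cmp \<Lambda> \<beta> \<tau>) \<tau>\<^sub>1) \<tau>\<^sub>2)"
    using cmp_assoc[OF c(1,2)] cmp_assoc[OF 1 3(3)] cmp_assoc[OF 2 c(4)] by simp
  moreover have "deg \<Lambda> (cmp \<Lambda> (cmp \<Lambda> \<beta> \<tau>) \<tau>\<^sub>1) = deg \<Lambda> \<beta> + deg \<Lambda> \<tau> + deg \<Lambda> \<tau>\<^sub>1"
    using deg_cmp[OF 2] deg_cmp[OF c(2)] by simp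
  ultimately show ?thesis
    using segment_cmp[OF 3(2,1)] by simp
qed

text \<open>
  Write \<open>\<rho> = \<mu>\<beta> = \<nu>\<gamma>\<close> with \<open>d(\<mu>) = d(\<gamma>) = m\<close> and \<open>d(\<nu>) = d(\<beta>) = n\<close>, and let \<open>\<tau>'\<close> be a path of degree
  \<open>m + n\<close> that extends \<open>\<tau>\<close>. The shift by \<open>m\<close> of \<open>\<rho>\<tau>\<tau>'\<close> begins with \<open>\<beta>\<tau>\<close>, the shift by \<open>n\<close> begins
  with \<open>\<gamma>\<tau>\<close>, and periodicity identifies the two shifts up to degree \<open>m + n + d(\<tau>)\<close>.
\<close>

lemma periodic_tails_mce:
  assumes ns: "no_sources \<Lambda>" and P: "periodic_on \<Lambda> W m n" and J: "m \<squnion>\<^sub>v n = m + n"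
    and \<rho>: "\<rho> \<in> paths_into \<Lambda> W" "deg \<Lambda> \<rho> = m + n" and \<tau>: "(\<rho>, \<tau>) \<in> composable \<Lambda>"
  shows "mce \<Lambda> (cmp \<Lambda> (segment \<Lambda> \<rho> m (m + n)) \<tau>) (cmp \<Lambda> (segment \<Lambda> \<rho> n (m + n)) \<tau>) \<noteq> {}"
proof -
  have M: "\<rho> \<in> Mor \<Lambda>" using \<rho> by (simp add: paths_into_def)
  have \<rho>': "deg \<Lambda> \<rho> = n + m" using \<rho>(2) by (simp add: add.commute)
  from tail_factorization[OF M \<rho>(2)] obtain \<mu> \<beta> where
    b: "segment \<Lambda> \<rho> m (m + n) = \<beta>" "(\<mu>, \<beta>) \<in> composable \<Lambda>" "deg \<Lambda> \<mu> = m" "deg \<Lambda> \<beta> = n"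
      "\<rho> = cmp \<Lambda> \<mu> \<beta>" "src \<Lambda> \<beta> = src \<Lambda> \<rho>" .
  from tail_factorization[OF M \<rho>'] obtain \<nu> \<gamma> where
    g: "segment \<Lambda> \<rho> n (n + m) = \<gamma>" "(\<nu>, \<gamma>) \<in> composable \<Lambda>" "deg \<Lambda> \<nu> = n" "deg \<Lambda> \<gamma> = m"
      "\<rho> = cmp \<Lambda> \<nu> \<gamma>" "src \<Lambda> \<gamma> = src \<Lambda> \<rho>" .
  have bt: "(\<beta>, \<tau>) \<in> composable \<Lambda>" "(\<gamma>, \<tau>) \<in> composable \<Lambda>"
    using \<tau> b(2,6) g(2,6) by (auto simp: composable_def)
  have "src \<Lambda> \<tau> \<in> Obj \<Lambda>" using \<tau> src_Obj composableD by blast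
  from no_sources_path[OF ns this] obtain \<tau>' where
    t: "\<tau>' \<in> Mor \<Lambda>" "rng \<Lambda> \<tau>' = src \<Lambda> \<tau>" "deg \<Lambda> \<tau>' = m + n" .
  have t': "deg \<Lambda> \<tau>' = n + m" using t(3) by (simp add: add.commute)
  from factorize[OF t(1,3)] obtain \<tau>\<^sub>1 \<tau>\<^sub>2 where
    t12: "(\<tau>\<^sub>1, \<tau>\<^sub>2) \<in> composable \<Lambda>" "deg \<Lambda> \<tau>\<^sub>1 = m" "\<tau>' = cmp \<Lambda> \<tau>\<^sub>1 \<tau>\<^sub>2" .
  from factorize[OF t(1) t'] obtain \<tau>\<^sub>3 \<tau>\<^sub>4 where
    t34: "(\<tau>\<^sub>3, \<tau>\<^sub>4) \<in> composable \<Lambda>" "deg \<Lambda> \<tau>\<^sub>3 = n" "\<tau>' = cmp \<Lambda> \<tau>\<^sub>3 \<tau>\<^sub>4" .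
  have tt: "(\<tau>, \<tau>\<^sub>1) \<in> composable \<Lambda>" "(\<tau>, \<tau>\<^sub>3) \<in> composable \<Lambda>" "(\<tau>, \<tau>') \<in> composable \<Lambda>"
    using composableD[OF \<tau>] composableD[OF t12(1)] composableD[OF t34(1)]
      rng_cmp[OF t12(1)] rng_cmp[OF t34(1)] t t12(3) t34(3) by (auto simp: composable_def)
  define \<omega> where "\<omega> = cmp \<Lambda> (cmp \<Lambda> \<rho> \<tau>) \<tau>'"
  have rt: "(cmp \<Lambda> \<rho> \<tau>, \<tau>') \<in> composable \<Lambda>" using composable_assoc(2)[OF \<tau> tt(3)] .
  have "\<omega> \<in> paths_into \<Lambda> W"
    using cmp_Mor[OF rt] rng_cmp[OF rt] rng_cmp[OF \<tau>] \<rho> by (simp add: \<omega>_def paths_into_def)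
  moreover have "deg \<Lambda> \<omega> = (m \<squnion>\<^sub>v n) + (n + deg \<Lambda> \<tau> + m)"
    using deg_cmp[OF rt] deg_cmp[OF \<tau>] \<rho>(2) t(3) J by (simp add: \<omega>_def add_ac)
  ultimately have "segment \<Lambda> \<omega> m (m + (n + deg \<Lambda> \<tau> + m)) = segment \<Lambda> \<omega> n (n + (n + deg \<Lambda> \<tau> + m))"
    using P unfolding periodic_on_def by blast
  moreover have "segment \<Lambda> \<omega> m (m + (n + deg \<Lambda> \<tau> + m)) = cmp \<Lambda> (cmp \<Lambda> \<beta> \<tau>) \<tau>\<^sub>1"
    using segment_extension[OF b(2) bt(1) tt(1) t12(1)] b(3,4) t12(2) 
    unfolding \<omega>_def t12(3) b(5)[symmetric] by simp
  moreover have "segment \<Lambda> \<omega> n (n + (m + deg \<Lambda> \<tau> + n)) = cmp \<Lambda> (cmp \<Lambda> \<gamma> \<tau>) \<tau>\<^sub>3"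
    using segment_extension[OF g(2) bt(2) tt(2) t34(1)] g(3,4) t34(2)
    unfolding \<omega>_def t34(3) g(5)[symmetric] by simp
  moreover have "n + deg \<Lambda> \<tau> + m = m + deg \<Lambda> \<tau> + n" by (simp add: add_ac)
  ultimately have "cmp \<Lambda> (cmp \<Lambda> \<beta> \<tau>) \<tau>\<^sub>1 = cmp \<Lambda> (cmp \<Lambda> \<gamma> \<tau>) \<tau>\<^sub>3" by simp
  then have "mce \<Lambda> (cmp \<Lambda> \<beta> \<tau>) (cmp \<Lambda> \<gamma> \<tau>) \<noteq> {}"
    using common_extension_imp_mce composable_assoc(2) bt tt by blast
  then show ?thesis using b(1) g(1) by (simp add: add.commute)
qed

section \<open>Conditions (B) and (C) are equivalent\<close>


theorem condition_C_imp_condition_B: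
  assumes ns: "no_sources \<Lambda>" and C: "condition_C \<Lambda>"
  shows "condition_B \<Lambda>"
proof (rule ccontr)
  assume "\<not> condition_B \<Lambda>"
  from not_condition_B_imp_periodic[OF ns this] obtain W m n where
    W: "openin (otop \<Lambda>) W" "W \<noteq> {}" "m \<noteq> n" "m \<squnion>\<^sub>v n = m + n" "periodic_on \<Lambda> W m n" .
  let ?U = "paths_into \<Lambda> W \<inter> paths_of_degree \<Lambda> (m + n)"
  have U: "openin (mtop \<Lambda>) ?U"
    using W by (intro openin_Int openin_paths_into openin_paths_of_degree)
  obtain \<rho>\<^sub>0 where r0: "\<rho>\<^sub>0 \<in> ?U" using downstream_nonempty[OF ns W(1,2)] by blast
  from local_homeomorphism_injective_neighbourhood[OF local_homeomorphism_src U r0] obtain N where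
    N: "openin (mtop \<Lambda>) N" "\<rho>\<^sub>0 \<in> N" "N \<subseteq> ?U" "inj_on (src \<Lambda>) N" .
  define X where "X = (\<lambda>\<rho>. segment \<Lambda> \<rho> m (m + n)) ` N"
  define Y where "Y = (\<lambda>\<rho>. segment \<Lambda> \<rho> n (n + m)) ` N"
  have tail: "src \<Lambda> (segment \<Lambda> \<rho> m (m + n)) = src \<Lambda> \<rho>" "src \<Lambda> (segment \<Lambda> \<rho> n (n + m)) = src \<Lambda> \<rho>"
    "deg \<Lambda> (segment \<Lambda> \<rho> m (m + n)) = n" "deg \<Lambda> (segment \<Lambda> \<rho> n (n + m)) = m"
    if "\<rho> \<in> N" for \<rho>
  proof -
    have "\<rho> \<in> Mor \<Lambda>" "deg \<Lambda> \<rho> = m + n" "deg \<Lambda> \<rho> = n + m"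
      using that N(3) by (auto simp: paths_of_degree_def add.commute)
    then show "src \<Lambda> (segment \<Lambda> \<rho> m (m + n)) = src \<Lambda> \<rho>" "src \<Lambda> (segment \<Lambda> \<rho> n (n + m)) = src \<Lambda> \<rho>"
      "deg \<Lambda> (segment \<Lambda> \<rho> m (m + n)) = n" "deg \<Lambda> (segment \<Lambda> \<rho> n (n + m)) = m"
      using tail_factorization by metis+
  qed
  have XY: "openin (mtop \<Lambda>) X" "openin (mtop \<Lambda>) Y"
    unfolding X_def Y_def using N by (intro openin_tails; auto simp: add.commute)+
  have src: "src \<Lambda> ` X = src \<Lambda> ` N" "src \<Lambda> ` Y = src \<Lambda> ` N"
    unfolding X_def Y_def using tail by (force simp: image_image)+
  have inj: "inj_on (src \<Lambda>) X" "inj_on (src \<Lambda>) Y"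
    using N(4) tail unfolding X_def Y_def inj_on_def by auto
  have hom: "homeomorphic_map (subtopology (mtop \<Lambda>) X) (subtopology (otop \<Lambda>) (src \<Lambda> ` X)) (src \<Lambda>)"
    "homeomorphic_map (subtopology (mtop \<Lambda>) Y) (subtopology (otop \<Lambda>) (src \<Lambda> ` Y)) (src \<Lambda>)"
    using local_homeomorphism_injective_imp_homeomorphic_map[OF local_homeomorphism_src continuous_src]
      XY inj by blast+
  have "X \<noteq> Y"
  proof
    assume "X = Y"
    then obtain \<rho> where "\<rho> \<in> N" "segment \<Lambda> \<rho>\<^sub>0 m (m + n) = segment \<Lambda> \<rho> n (n + m)"
      using N(2) unfolding X_def Y_def by blast
    then show False using tail N(2) W(3) by metis
  qed
  then obtain \<tau> where t: "\<tau> \<in> paths_into \<Lambda> (src \<Lambda> ` X)"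
      "MCE \<Lambda> (set_cmp \<Lambda> X {\<tau>}) (set_cmp \<Lambda> Y {\<tau>}) = {}"
    using C[unfolded condition_C_def, rule_format, of X Y] XY src hom by auto
  then obtain \<rho> where r: "\<rho> \<in> N" "rng \<Lambda> \<tau> = src \<Lambda> \<rho>" "\<tau> \<in> Mor \<Lambda>"
    unfolding src by (auto simp: paths_into_def)
  have rU: "\<rho> \<in> paths_into \<Lambda> W" "deg \<Lambda> \<rho> = m + n" "(\<rho>, \<tau>) \<in> composable \<Lambda>"
    using N(3) r by (auto simp: paths_of_degree_def composable_def)
  have "segment \<Lambda> \<rho> m (m + n) \<in> X" "segment \<Lambda> \<rho> n (m + n) \<in> Y"
    unfolding X_def Y_def add.commute[of m n] using r(1) by simp_all
  then have "cmp \<Lambda> (segment \<Lambda> \<rho> m (m + n)) \<tau> \<in> set_cmp \<Lambda> X {\<tau>}"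
    "cmp \<Lambda> (segment \<Lambda> \<rho> n (m + n)) \<tau> \<in> set_cmp \<Lambda> Y {\<tau>}"
    using r(2) tail(1,2)[OF r(1)] unfolding set_cmp_def by (fastforce simp: add.commute[of n m])+
  then show False
    using periodic_tails_mce[OF ns W(5,4) rU] t(2) unfolding MCE_def by blast
qed

text \<open>
  Since \<open>X \<noteq> Y\<close> but \<open>s(X) = s(Y)\<close>, some vertex is the source of distinct paths \<open>\<mu>\<close> in \<open>X\<close> and \<open>\<nu>\<close> in
  \<open>Y\<close>. If they have the same degree, they cannot have a common extension and \<open>\<tau>\<close> can be the vertex.
  Otherwise \<open>\<tau>\<close> comes from (B).
\<close>

theorem condition_B_imp_condition_C:
  assumes B: "condition_B \<Lambda>"
  shows "condition_C \<Lambda>"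
  unfolding condition_C_def
proof (intro allI impI; elim conjE)
  fix X Y
  assume X: "openin (mtop \<Lambda>) X" and Y: "openin (mtop \<Lambda>) Y" and ne: "X \<noteq> Y"
    and src: "src \<Lambda> ` X = src \<Lambda> ` Y"
    and hX: "homeomorphic_map (subtopology (mtop \<Lambda>) X) (subtopology (otop \<Lambda>) (src \<Lambda> ` X)) (src \<Lambda>)"
    and hY: "homeomorphic_map (subtopology (mtop \<Lambda>) Y) (subtopology (otop \<Lambda>) (src \<Lambda> ` Y)) (src \<Lambda>)"
  have XM: "X \<subseteq> Mor \<Lambda>" "Y \<subseteq> Mor \<Lambda>" using X Y openin_subset by auto
  have inj: "inj_on (src \<Lambda>) X" "inj_on (src \<Lambda>) Y"
    using homeomorphic_imp_injective_map[OF hX] homeomorphic_imp_injective_map[OF hY] XM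
    by (simp_all add: Int_absorb1)
  have "\<exists>\<mu>\<in>X. \<exists>\<nu>\<in>Y. src \<Lambda> \<mu> = src \<Lambda> \<nu> \<and> \<mu> \<noteq> \<nu>"
  proof (rule ccontr)
    assume no: "\<not> ?thesis"
    have "\<mu> \<in> Y" if "\<mu> \<in> X" for \<mu>
    proof -
      have "src \<Lambda> \<mu> \<in> src \<Lambda> ` Y" unfolding src[symmetric] using that by simp
      then show ?thesis using no that by blast
    qed
    moreover have "\<nu> \<in> X" if "\<nu> \<in> Y" for \<nu>
    proof -
      have "src \<Lambda> \<nu> \<in> src \<Lambda> ` X" unfolding src using that by simp
      then obtain \<mu> where "\<mu> \<in> X" "src \<Lambda> \<mu> = src \<Lambda> \<nu>" by (metis imageE)
      then show ?thesis using no that by metis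
    qed
    ultimately show False using ne by blast
  qed
  then obtain \<mu> \<nu> where mn: "\<mu> \<in> X" "\<nu> \<in> Y" "src \<Lambda> \<mu> = src \<Lambda> \<nu>" "\<mu> \<noteq> \<nu>" by blast
  show "\<exists>\<tau>\<in>paths_into \<Lambda> (src \<Lambda> ` X). MCE \<Lambda> (set_cmp \<Lambda> X {\<tau>}) (set_cmp \<Lambda> Y {\<tau>}) = {}"
  proof (cases "deg \<Lambda> \<mu> = deg \<Lambda> \<nu>")
    case True
    let ?\<tau> = "idt \<Lambda> (src \<Lambda> \<mu>)"
    have o: "src \<Lambda> \<mu> \<in> Obj \<Lambda>" using mn(1) XM src_Obj by blast
    have t: "?\<tau> \<in> paths_into \<Lambda> (src \<Lambda> ` X)"
      using o mn(1) by (simp add: paths_into_def idt_Mor rng_idt)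
    have m: "\<mu> \<in> Mor \<Lambda>" "\<nu> \<in> Mor \<Lambda>" using mn XM by auto
    have "cmp \<Lambda> \<mu> ?\<tau> = \<mu>" "cmp \<Lambda> \<nu> ?\<tau> = \<nu>"
      using cmp_idt[OF m(1)] cmp_idt[OF m(2)] mn(3) by simp_all
    moreover have "\<mu>' = \<mu>" if "\<mu>' \<in> X" "src \<Lambda> \<mu>' = rng \<Lambda> ?\<tau>" for \<mu>'
      using inj_onD[OF inj(1) _ that(1) mn(1)] that(2) rng_idt[OF o] by simp
    moreover have "\<nu>' = \<nu>" if "\<nu>' \<in> Y" "src \<Lambda> \<nu>' = rng \<Lambda> ?\<tau>" for \<nu>'
      using inj_onD[OF inj(2) _ that(1) mn(2)] that(2) rng_idt[OF o] mn(3) by simp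
    ultimately have "set_cmp \<Lambda> X {?\<tau>} \<subseteq> {\<mu>}" "set_cmp \<Lambda> Y {?\<tau>} \<subseteq> {\<nu>}"
      unfolding set_cmp_def by fastforce+
    moreover have "mce \<Lambda> \<mu> \<nu> = {}"
      using True mn(4) factorization_cancel(1) unfolding mce_def by fastforce
    ultimately have "MCE \<Lambda> (set_cmp \<Lambda> X {?\<tau>}) (set_cmp \<Lambda> Y {?\<tau>}) = {}"
      unfolding MCE_def by blast
    then show ?thesis using t by blast
  next
    case False
    define m n where "m = deg \<Lambda> \<mu>" and "n = deg \<Lambda> \<nu>"
    \<comment> \<open>In a common extension of \<open>\<mu>\<tau>\<close> and \<open>\<nu>\<tau>\<close>, the segments of \<open>\<tau>\<close> at \<open>m'\<close> and \<open>n'\<close> both start at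
      \<open>m \<or> n\<close>.\<close>
    define m' n' where "m' = (m \<squnion>\<^sub>v n) - m" and "n' = (m \<squnion>\<^sub>v n) - n"
    have mm: "m + m' = m \<squnion>\<^sub>v n" "n + n' = m \<squnion>\<^sub>v n"
      unfolding m'_def n'_def by (simp_all add: vjoin_upper)
    then have "m' \<noteq> n'" using False by (metis add_right_cancel m_def n_def)
    define U where "U = src \<Lambda> ` (X \<inter> paths_of_degree \<Lambda> m) \<inter> src \<Lambda> ` (Y \<inter> paths_of_degree \<Lambda> n)"
    have "openin (otop \<Lambda>) U"
      unfolding U_def using X Y by (intro openin_Int openin_src_image openin_paths_of_degree)
    moreover have "src \<Lambda> \<mu> \<in> U"
    proof -
      have "\<mu> \<in> X \<inter> paths_of_degree \<Lambda> m" "\<nu> \<in> Y \<inter> paths_of_degree \<Lambda> n"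
        using mn XM by (auto simp: paths_of_degree_def m_def n_def)
      then show ?thesis unfolding U_def using mn(3) by (metis IntI imageI)
    qed
    ultimately have "\<not> periodic_on \<Lambda> U m' n'"
      using B \<open>m' \<noteq> n'\<close> condition_B_iff by blast
    then obtain \<tau> q where t: "\<tau> \<in> paths_into \<Lambda> U" "deg \<Lambda> \<tau> = (m' \<squnion>\<^sub>v n') + q"
        "segment \<Lambda> \<tau> m' (m' + q) \<noteq> segment \<Lambda> \<tau> n' (n' + q)"
      unfolding periodic_on_def by blast
    have tM: "\<tau> \<in> Mor \<Lambda>" "rng \<Lambda> \<tau> \<in> U" using t(1) by (auto simp: paths_into_def)
    have "mce \<Lambda> \<alpha> \<beta> = {}" if ab: "\<alpha> \<in> set_cmp \<Lambda> X {\<tau>}" "\<beta> \<in> set_cmp \<Lambda> Y {\<tau>}" for \<alpha> \<beta>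
    proof (rule equals0I)
      fix \<omega> assume w: "\<omega> \<in> mce \<Lambda> \<alpha> \<beta>"
      obtain \<mu>' \<nu>' where 1: "\<mu>' \<in> X" "src \<Lambda> \<mu>' = rng \<Lambda> \<tau>" "\<alpha> = cmp \<Lambda> \<mu>' \<tau>"
          "\<nu>' \<in> Y" "src \<Lambda> \<nu>' = rng \<Lambda> \<tau>" "\<beta> = cmp \<Lambda> \<nu>' \<tau>"
        using ab unfolding set_cmp_def by blast
      have 2: "deg \<Lambda> \<mu>' = m" "deg \<Lambda> \<nu>' = n"
        using tM(2) 1 inj unfolding U_def inj_on_def paths_of_degree_def by force+
      have 3: "(\<mu>', \<tau>) \<in> composable \<Lambda>" "(\<nu>', \<tau>) \<in> composable \<Lambda>"
        using 1 tM XM by (auto simp: composable_def)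
      obtain \<gamma> \<delta> where 4: "(\<alpha>, \<gamma>) \<in> composable \<Lambda>" "(\<beta>, \<delta>) \<in> composable \<Lambda>" "\<omega> = cmp \<Lambda> \<alpha> \<gamma>" "\<omega> = cmp \<Lambda> \<beta> \<delta>"
        using w unfolding mce_def by blast
      have read: "segment \<Lambda> (cmp \<Lambda> (cmp \<Lambda> \<kappa> \<tau>) \<xi>) (deg \<Lambda> \<kappa> + j) (deg \<Lambda> \<kappa> + j + q) = segment \<Lambda> \<tau> j (j + q)"
        if "j \<le> m' \<squnion>\<^sub>v n'" "(\<kappa>, \<tau>) \<in> composable \<Lambda>" "(cmp \<Lambda> \<kappa> \<tau>, \<xi>) \<in> composable \<Lambda>" for j \<kappa> \<xi>
      proof -
        have "j + q \<le> deg \<Lambda> \<tau>" using that(1) t(2) by (simp add: add_right_mono)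
        moreover from this have "deg \<Lambda> \<kappa> + j + q \<le> deg \<Lambda> (cmp \<Lambda> \<kappa> \<tau>)"
          using deg_cmp[OF that(2)] by (simp add: add.assoc add_left_mono)
        ultimately show ?thesis
          using segment_cmp_left[OF that(3), of "deg \<Lambda> \<kappa> + j" "deg \<Lambda> \<kappa> + j + q"]
            segment_cmp_right[OF that(2), of j "j + q"] by (simp add: add.assoc)
      qed
      have "segment \<Lambda> \<omega> (m + m') (m + m' + q) = segment \<Lambda> \<tau> m' (m' + q)"
        "segment \<Lambda> \<omega> (n + n') (n + n' + q) = segment \<Lambda> \<tau> n' (n' + q)"
        using read[OF vjoin_upper(1) 3(1), of \<gamma>] read[OF vjoin_upper(2) 3(2), of \<delta>] 1 2 4 by simp_all
      then show False using t(3) mm by simp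
    qed
    then have "MCE \<Lambda> (set_cmp \<Lambda> X {\<tau>}) (set_cmp \<Lambda> Y {\<tau>}) = {}"
      unfolding MCE_def by blast
    moreover have "\<tau> \<in> paths_into \<Lambda> (src \<Lambda> ` X)"
      using tM unfolding U_def paths_into_def by blast
    ultimately show ?thesis by blast
  qed
qed

end


section \<open>Segments and shifts of elements of the path space\<close>


lemma path_spaceD:
  assumes "x \<in> path_space \<Lambda>"
  shows "continuous_degree_functor (Omega (pdeg x)) \<Lambda> (snd x)"
  using assms by (auto simp: path_space_def)

context topological_kgraph
begin


text \<open>
  An element of the path space is a functor on morphisms only, so its vertices are read off from the
  identities that it takes as values.
\<close>

lemma pseg_props:
  assumes "x \<in> path_space \<Lambda>" "p \<le> q" "to_enat q \<le> pdeg x"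
  shows "pseg x p q \<in> Mor \<Lambda>" "deg \<Lambda> (pseg x p q) = q - p"
    "pseg x p p = idt \<Lambda> (rng \<Lambda> (pseg x p q))" "pseg x q q = idt \<Lambda> (src \<Lambda> (pseg x p q))"
    "vertex_at \<Lambda> x p = rng \<Lambda> (pseg x p q)" "vertex_at \<Lambda> x q = src \<Lambda> (pseg x p q)"
proof -
  note F = path_spaceD[OF assms(1), unfolded continuous_degree_functor_Omega]
  show *: "pseg x p q \<in> Mor \<Lambda>" "deg \<Lambda> (pseg x p q) = q - p"
    "pseg x p p = idt \<Lambda> (rng \<Lambda> (pseg x p q))" "pseg x q q = idt \<Lambda> (src \<Lambda> (pseg x p q))"
    using F assms(2,3) by blast+
  then show "vertex_at \<Lambda> x p = rng \<Lambda> (pseg x p q)" "vertex_at \<Lambda> x q = src \<Lambda> (pseg x p q)"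
    using rng_idt rng_Obj src_Obj unfolding vertex_at_def by simp_all
qed

lemma cmp_pseg:
  assumes "x \<in> path_space \<Lambda>" "p \<le> q" "q \<le> t" "to_enat t \<le> pdeg x"
  shows "(pseg x p q, pseg x q t) \<in> composable \<Lambda>" "cmp \<Lambda> (pseg x p q) (pseg x q t) = pseg x p t"
  using functor_composable[OF path_spaceD[OF assms(1)] assms(2-4)]
    path_spaceD[OF assms(1), unfolded continuous_degree_functor_Omega] assms(2-4) by metis+

lemma segment_pseg:
  assumes x: "x \<in> path_space \<Lambda>" and "p \<le> q" "q \<le> t" "to_enat t \<le> pdeg x"
  shows "segment \<Lambda> (pseg x 0 t) p q = pseg x p q"
proof -
  have e: "to_enat q \<le> pdeg x" "to_enat p \<le> pdeg x" "p \<le> t" using assms to_enat_le_mono order_trans by blast+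
  have "pseg x 0 t = cmp \<Lambda> (pseg x 0 p) (cmp \<Lambda> (pseg x p q) (pseg x q t))"
    using cmp_pseg(2)[OF x, of 0 p t] cmp_pseg(2)[OF x, of p q t] assms e by simp
  moreover have "(pseg x 0 p, pseg x p q) \<in> composable \<Lambda>" "(pseg x p q, pseg x q t) \<in> composable \<Lambda>"
    using cmp_pseg(1)[OF x, of 0 p q] cmp_pseg(1)[OF x, of p q t] assms e by simp_all
  moreover have "p = deg \<Lambda> (pseg x 0 p)" "q = deg \<Lambda> (pseg x 0 p) + deg \<Lambda> (pseg x p q)"
    using pseg_props(2)[OF x] e assms by simp_all
  ultimately show ?thesis
    using segment_cmp by metis
qed

lemma pseg_shift:
  assumes x: "x \<in> path_space \<Lambda>" "to_enat m \<le> pdeg x" and q: "to_enat (m + q) \<le> pdeg x"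
  shows "pseg (shift \<Lambda> m x) 0 q = pseg x m (m + q)"
  using theI'[OF shift_ex1[OF x]] q to_enat_le_diff[OF x(2)] unfolding shift_def by blast

lemma shift_eqI:
  assumes "pdeg x - to_enat m = pdeg x - to_enat n"
    and "\<And>q. to_enat q \<le> pdeg x - to_enat m \<Longrightarrow> pseg x m (m + q) = pseg x n (n + q)"
  shows "shift \<Lambda> m x = shift \<Lambda> n x"
  unfolding shift_def using assms by (metis (no_types, lifting))

lemma shift_eqD:
  assumes x: "x \<in> path_space \<Lambda>" and inf: "\<And>i. pdeg x $ i = \<infinity>" and eq: "shift \<Lambda> m x = shift \<Lambda> n x"
  shows "pseg x (s + m) (s + m + q) = pseg x (s + n) (s + n + q)"
proof -
  have le: "to_enat q \<le> pdeg x" for q using to_enat_le_infinite inf .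
  have e: "pseg x m (m + r) = pseg x n (n + r)" for r
    using pseg_shift[OF x le le, of m r] pseg_shift[OF x le le, of n r] eq by simp
  have c: "(pseg x p (p + s), pseg x (p + s) (p + s + q)) \<in> composable \<Lambda>"
    "cmp \<Lambda> (pseg x p (p + s)) (pseg x (p + s) (p + s + q)) = pseg x p (p + (s + q))" for p
    using cmp_pseg[OF x _ _ le, of p "p + s" "p + s + q"] by (simp_all add: add.assoc)
  have "pseg x (m + s) (m + s + q) = pseg x (n + s) (n + s + q)"
    using factorization_cancel(2)[OF c(1)[of m] c(1)[of n]] c(2)[of m] c(2)[of n] e by simp
  then show ?thesis by (simp add: add.commute)
qed

section \<open>Condition (A) implies condition (B)\<close>


lemma MCE_degree:
  assumes "\<And>\<mu>. \<mu> \<in> X \<Longrightarrow> deg \<Lambda> \<mu> = m" "\<And>\<nu>. \<nu> \<in> Y \<Longrightarrow> deg \<Lambda> \<nu> = n"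
  shows "MCE \<Lambda> X Y \<subseteq> paths_of_degree \<Lambda> (m \<squnion>\<^sub>v n)"
  using assms by (auto simp: MCE_def mce_def paths_of_degree_def)

text \<open>
  This is where compact alignment enters. For \<open>\<rho> = \<mu>\<beta> = \<nu>\<gamma>\<close> in \<open>N\<close> and \<open>\<sigma>\<close> of degree \<open>m\<close> with
  \<open>r(\<sigma>) = s(\<rho>)\<close>, periodicity applied to \<open>\<rho>\<sigma>\<close> says that \<open>\<beta>\<sigma>\<close> begins with \<open>\<gamma>\<close>, so \<open>\<beta>\<sigma>\<close> is a minimal
  common extension of \<open>\<beta>\<close> and \<open>\<gamma>\<close>. Thus all such \<open>\<sigma>\<close> are tails of elements of a compact set.
\<close>

lemma periodic_compact_fibres:
  assumes ca: "compactly_aligned \<Lambda>"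
    and P: "periodic_on \<Lambda> W m n" and J: "m \<squnion>\<^sub>v n = m + n"
    and N: "compactin (mtop \<Lambda>) N" "N \<subseteq> paths_into \<Lambda> W \<inter> paths_of_degree \<Lambda> (m + n)"
  shows "compactin (mtop \<Lambda>) (paths_into \<Lambda> (src \<Lambda> ` N) \<inter> paths_of_degree \<Lambda> m)"
proof -
  define X where "X = (\<lambda>\<rho>. segment \<Lambda> \<rho> m (m + n)) ` N"
  define Y where "Y = (\<lambda>\<rho>. segment \<Lambda> \<rho> n (n + m)) ` N"
  define E where "E = (\<lambda>\<rho>. segment \<Lambda> \<rho> n (n + m)) ` MCE \<Lambda> X Y"
  have ND: "\<rho> \<in> Mor \<Lambda>" "\<rho> \<in> paths_into \<Lambda> W" "deg \<Lambda> \<rho> = m + n" "deg \<Lambda> \<rho> = n + m" if "\<rho> \<in> N" for \<rho>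
    using N(2) that by (auto simp: paths_of_degree_def add.commute)
  have Z: "MCE \<Lambda> X Y \<subseteq> paths_of_degree \<Lambda> (n + m)"
  proof -
    have "deg \<Lambda> \<mu> = n" if "\<mu> \<in> X" for \<mu>
      using that tail_factorization[OF ND(1,3)] unfolding X_def by blast
    moreover have "deg \<Lambda> \<nu> = m" if "\<nu> \<in> Y" for \<nu>
      using that tail_factorization[OF ND(1,4)] unfolding Y_def by blast
    ultimately show ?thesis
      using MCE_degree[of X n Y m] J vjoin_commute[of n m] by (simp add: add.commute)
  qed
  have "compactin (mtop \<Lambda>) X" "compactin (mtop \<Lambda>) Y"
    unfolding X_def Y_def using N by (intro compactin_segment_image[where t = "m + n"]; auto simp: add.commute)+
  then have "compactin (mtop \<Lambda>) (MCE \<Lambda> X Y)"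
    using ca unfolding compactly_aligned_def by blast
  then have E: "compactin (mtop \<Lambda>) E"
    unfolding E_def using Z by (intro compactin_segment_image[where t = "n + m"]) simp_all
  have "closedin (otop \<Lambda>) (src \<Lambda> ` N)"
    using compactin_imp_closedin[OF Hausdorff_otop image_compactin[OF N(1) continuous_src]] .
  then have cl: "closedin (mtop \<Lambda>) (paths_into \<Lambda> (src \<Lambda> ` N))"
    using closedin_continuous_map_preimage[OF continuous_rng] by (simp add: paths_into_def)
  have "paths_into \<Lambda> (src \<Lambda> ` N) \<inter> paths_of_degree \<Lambda> m = paths_into \<Lambda> (src \<Lambda> ` N) \<inter> E"
  proof (intro equalityI subsetI IntI)
    fix \<sigma> assume "\<sigma> \<in> paths_into \<Lambda> (src \<Lambda> ` N) \<inter> E"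
    then obtain \<rho> where "\<rho> \<in> MCE \<Lambda> X Y" "\<sigma> = segment \<Lambda> \<rho> n (n + m)"
      unfolding E_def by blast
    then show "\<sigma> \<in> paths_of_degree \<Lambda> m"
      using Z segment_Mor[of \<rho> n "n + m"] deg_segment[of \<rho> n "n + m"] by (auto simp: paths_of_degree_def)
  next
    fix \<sigma> assume s: "\<sigma> \<in> paths_into \<Lambda> (src \<Lambda> ` N) \<inter> paths_of_degree \<Lambda> m"
    then obtain \<rho> where r: "\<rho> \<in> N" "rng \<Lambda> \<sigma> = src \<Lambda> \<rho>" "\<sigma> \<in> Mor \<Lambda>" "deg \<Lambda> \<sigma> = m"
      by (auto simp: paths_into_def paths_of_degree_def)
    from tail_factorization[OF ND(1,3)[OF r(1)]] obtain \<mu> \<beta> where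
      b: "segment \<Lambda> \<rho> m (m + n) = \<beta>" "(\<mu>, \<beta>) \<in> composable \<Lambda>" "deg \<Lambda> \<mu> = m" "deg \<Lambda> \<beta> = n"
        "\<rho> = cmp \<Lambda> \<mu> \<beta>" "src \<Lambda> \<beta> = src \<Lambda> \<rho>" .
    from tail_factorization[OF ND(1,4)[OF r(1)]] obtain \<nu> \<gamma> where
      g: "segment \<Lambda> \<rho> n (n + m) = \<gamma>" "(\<nu>, \<gamma>) \<in> composable \<Lambda>" "deg \<Lambda> \<nu> = n" "deg \<Lambda> \<gamma> = m"
        "\<rho> = cmp \<Lambda> \<nu> \<gamma>" "src \<Lambda> \<gamma> = src \<Lambda> \<rho>" .
    have c: "(\<beta>, \<sigma>) \<in> composable \<Lambda>" "(\<gamma>, \<sigma>) \<in> composable \<Lambda>" "(\<rho>, \<sigma>) \<in> composable \<Lambda>"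
      using r b(2,6) g(2,6) ND(1) by (auto simp: composable_def)
    have "deg \<Lambda> (cmp \<Lambda> \<beta> \<sigma>) = m + n" using deg_cmp[OF c(1)] b(4) r(4) by (simp add: add.commute)
    from factorize[OF cmp_Mor[OF c(1)] this] obtain \<kappa> \<xi> where
      k: "(\<kappa>, \<xi>) \<in> composable \<Lambda>" "deg \<Lambda> \<kappa> = m" "deg \<Lambda> \<xi> = n" "cmp \<Lambda> \<beta> \<sigma> = cmp \<Lambda> \<kappa> \<xi>" .
    have "(\<mu>, cmp \<Lambda> \<beta> \<sigma>) \<in> composable \<Lambda>" using composable_assoc(1)[OF b(2) c(1)] .
    then have mk: "(\<mu>, \<kappa>) \<in> composable \<Lambda>" using composable_cmp_rightD[OF k(1)] k(4) by simp
    have "cmp \<Lambda> \<rho> \<sigma> = cmp \<Lambda> \<mu> (cmp \<Lambda> \<kappa> \<xi>)" "cmp \<Lambda> \<rho> \<sigma> = cmp \<Lambda> \<nu> (cmp \<Lambda> \<gamma> \<sigma>)"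
      using cmp_assoc[OF b(2) c(1)] cmp_assoc[OF g(2) c(2)] b(5) g(5) k(4) by simp_all
    then have "segment \<Lambda> (cmp \<Lambda> \<rho> \<sigma>) m (m + m) = \<kappa>" "segment \<Lambda> (cmp \<Lambda> \<rho> \<sigma>) n (n + m) = \<gamma>"
      using segment_cmp[OF mk k(1), of m "m + m"] segment_cmp[OF g(2) c(2), of n "n + m"]
        b(3) k(2) g(3,4) by simp_all
    moreover have "segment \<Lambda> (cmp \<Lambda> \<rho> \<sigma>) m (m + m) = segment \<Lambda> (cmp \<Lambda> \<rho> \<sigma>) n (n + m)"
    proof -
      have "cmp \<Lambda> \<rho> \<sigma> \<in> paths_into \<Lambda> W"
        using ND(2)[OF r(1)] cmp_Mor[OF c(3)] rng_cmp[OF c(3)] by (simp add: paths_into_def)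
      moreover have "deg \<Lambda> (cmp \<Lambda> \<rho> \<sigma>) = (m \<squnion>\<^sub>v n) + m"
        using deg_cmp[OF c(3)] ND(3)[OF r(1)] r(4) J by simp
      ultimately show ?thesis using P unfolding periodic_on_def by blast
    qed
    ultimately have "\<kappa> = \<gamma>" by simp
    then have "cmp \<Lambda> \<beta> \<sigma> \<in> mce \<Lambda> \<beta> \<gamma>"
      using mceI[OF c(1), of \<gamma> \<xi>] k b(4) g(4) r(4) J vjoin_commute[of n m] by (simp add: add.commute)
    moreover have "\<beta> \<in> X" "\<gamma> \<in> Y"
      unfolding X_def Y_def using r(1) b(1) g(1) by blast+
    ultimately have "cmp \<Lambda> \<beta> \<sigma> \<in> MCE \<Lambda> X Y"
      unfolding MCE_def by blast
    moreover have "segment \<Lambda> (cmp \<Lambda> \<beta> \<sigma>) n (n + m) = \<sigma>"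
      using segment_suffix[OF c(1)] b(4) r(4) by simp
    ultimately show "\<sigma> \<in> E" unfolding E_def by force
  qed blast+
  then show ?thesis
    using closed_Int_compactin[OF cl E] by simp
qed

text \<open>
  For a compact neighbourhood \<open>N\<close> of a path \<open>\<rho>\<close> with source \<open>u\<close>, take \<open>E = s(N)\<Lambda>\<^sup>m\<close>. In the absence of
  sources every path \<open>\<sigma>\<close> with range in \<open>s(N)\<close> extends to one of degree at least \<open>m\<close>, whose initial
  segment of degree \<open>m\<close> lies in \<open>E\<close> and has a common extension with \<open>\<sigma>\<close>.
\<close>

lemma periodic_compact_exhaustive:
  assumes ns: "no_sources \<Lambda>" and ca: "compactly_aligned \<Lambda>" and W: "openin (otop \<Lambda>) W"
    and P: "periodic_on \<Lambda> W m n" and J: "m \<squnion>\<^sub>v n = m + n"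
    and u: "u \<in> src \<Lambda> ` (paths_into \<Lambda> W \<inter> paths_of_degree \<Lambda> (m + n))"
  obtains E where "compact_exhaustive \<Lambda> u E" "E \<subseteq> paths_of_degree \<Lambda> m"
proof -
  obtain \<rho> where r: "\<rho> \<in> paths_into \<Lambda> W \<inter> paths_of_degree \<Lambda> (m + n)" "u = src \<Lambda> \<rho>" using u by blast
  have "openin (mtop \<Lambda>) (paths_into \<Lambda> W \<inter> paths_of_degree \<Lambda> (m + n))"
    using W by (intro openin_Int openin_paths_into openin_paths_of_degree)
  from compact_neighbourhood[OF locally_compact_mtop Hausdorff_mtop this r(1)] obtain U N where
    N: "openin (mtop \<Lambda>) U" "compactin (mtop \<Lambda>) N" "\<rho> \<in> U" "U \<subseteq> N"
      "N \<subseteq> paths_into \<Lambda> W \<inter> paths_of_degree \<Lambda> (m + n)" .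
  define E where "E = paths_into \<Lambda> (src \<Lambda> ` N) \<inter> paths_of_degree \<Lambda> m"
  have E: "compactin (mtop \<Lambda>) E"
    unfolding E_def using periodic_compact_fibres[OF ca P J N(2,5)] .
  have sN: "src \<Lambda> ` N \<subseteq> Obj \<Lambda>"
    using compactin_subset_topspace[OF N(2)] src_Obj by blast
  have rE: "rng \<Lambda> ` E = src \<Lambda> ` N"
  proof
    show "rng \<Lambda> ` E \<subseteq> src \<Lambda> ` N" by (auto simp: E_def paths_into_def)
    show "src \<Lambda> ` N \<subseteq> rng \<Lambda> ` E"
    proof
      fix v assume v: "v \<in> src \<Lambda> ` N"
      then have "v \<in> Obj \<Lambda>" using sN by blast
      from no_sources_path[OF ns this] obtain \<sigma> where "\<sigma> \<in> Mor \<Lambda>" "rng \<Lambda> \<sigma> = v" "deg \<Lambda> \<sigma> = m" .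
      then have "\<sigma> \<in> E" "v = rng \<Lambda> \<sigma>"
        using v by (simp_all add: E_def paths_into_def paths_of_degree_def)
      then show "v \<in> rng \<Lambda> ` E" by blast
    qed
  qed
  have "compact_exhaustive \<Lambda> u E"
    unfolding compact_exhaustive_def
  proof (intro conjI ballI)
    show "compactin (mtop \<Lambda>) E" by (fact E)
    show "\<exists>U. openin (otop \<Lambda>) U \<and> u \<in> U \<and> U \<subseteq> rng \<Lambda> ` E"
      unfolding rE using openin_src_image[OF N(1)] N(3,4) r(2) by blast
    fix \<sigma> assume "\<sigma> \<in> paths_into \<Lambda> (rng \<Lambda> ` E)"
    then have s: "\<sigma> \<in> Mor \<Lambda>" "rng \<Lambda> \<sigma> \<in> src \<Lambda> ` N"
      unfolding rE paths_into_def by auto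
    from no_sources_path[OF ns src_Obj[OF s(1)]] obtain \<tau> where
      t: "\<tau> \<in> Mor \<Lambda>" "rng \<Lambda> \<tau> = src \<Lambda> \<sigma>" "deg \<Lambda> \<tau> = m" .
    have c: "(\<sigma>, \<tau>) \<in> composable \<Lambda>" using s t by (simp add: composable_def)
    have "deg \<Lambda> (cmp \<Lambda> \<sigma> \<tau>) = m + deg \<Lambda> \<sigma>" using deg_cmp[OF c] t(3) by (simp add: add.commute)
    from factorize[OF cmp_Mor[OF c] this] obtain \<kappa> \<xi> where
      k: "(\<kappa>, \<xi>) \<in> composable \<Lambda>" "deg \<Lambda> \<kappa> = m" "cmp \<Lambda> \<sigma> \<tau> = cmp \<Lambda> \<kappa> \<xi>" .
    have "rng \<Lambda> \<kappa> = rng \<Lambda> \<sigma>" using rng_cmp[OF c] rng_cmp[OF k(1)] k(3) by simp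
    then have "\<kappa> \<in> E"
      using k(2) s(2) composableD(1)[OF k(1)] by (simp add: E_def paths_into_def paths_of_degree_def)
    then show "\<exists>\<mu>\<in>E. mce \<Lambda> \<sigma> \<mu> \<noteq> {}"
      using common_extension_imp_mce[OF c k(1,3)] by blast
  qed
  then show ?thesis using that unfolding E_def by blast
qed

text \<open>
  If \<open>\<mu>\<close> has degree \<open>n\<close> then the path \<open>\<mu>\<rho>\<close> can be cut again so that the factor of degree \<open>n\<close> comes
  last; its range is then further down, but still in \<open>W\<close>.
\<close>

lemma downstream_invariant:
  assumes "v \<in> src \<Lambda> ` (paths_into \<Lambda> W \<inter> paths_of_degree \<Lambda> n)" "src \<Lambda> ` paths_into \<Lambda> W \<subseteq> W"
    and "\<rho> \<in> Mor \<Lambda>" "rng \<Lambda> \<rho> = v"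
  shows "src \<Lambda> \<rho> \<in> src \<Lambda> ` (paths_into \<Lambda> W \<inter> paths_of_degree \<Lambda> n)"
proof -
  obtain \<mu> where m: "\<mu> \<in> Mor \<Lambda>" "rng \<Lambda> \<mu> \<in> W" "deg \<Lambda> \<mu> = n" "src \<Lambda> \<mu> = rng \<Lambda> \<rho>"
    using assms(1,4) by (auto simp: paths_into_def paths_of_degree_def)
  have c: "(\<mu>, \<rho>) \<in> composable \<Lambda>" using m assms(3) by (simp add: composable_def)
  have "deg \<Lambda> (cmp \<Lambda> \<mu> \<rho>) = deg \<Lambda> \<rho> + n" using deg_cmp[OF c] m(3) by (simp add: add.commute)
  from factorize[OF cmp_Mor[OF c] this] obtain \<alpha> \<beta> where
    f: "(\<alpha>, \<beta>) \<in> composable \<Lambda>" "deg \<Lambda> \<beta> = n" "cmp \<Lambda> \<mu> \<rho> = cmp \<Lambda> \<alpha> \<beta>" .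
  have e: "rng \<Lambda> \<alpha> = rng \<Lambda> \<mu>" "src \<Lambda> \<beta> = src \<Lambda> \<rho>"
    using f(3) rng_cmp[OF c] rng_cmp[OF f(1)] src_cmp[OF c] src_cmp[OF f(1)] by simp_all
  then have "\<alpha> \<in> paths_into \<Lambda> W" using m(2) composableD(1)[OF f(1)] by (simp add: paths_into_def)
  then have "rng \<Lambda> \<beta> \<in> W" using assms(2) composableD(3)[OF f(1)] by (metis image_subset_iff)
  then have "\<beta> \<in> paths_into \<Lambda> W \<inter> paths_of_degree \<Lambda> n"
    using f(2) composableD(2)[OF f(1)] by (simp add: paths_into_def paths_of_degree_def)
  then show ?thesis using e(2) by (metis imageI)
qed

text \<open>
  If \<open>x\<close> stopped in direction \<open>i\<close>, go to a vertex where it has stopped. By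
  \<open>periodic_compact_exhaustive\<close> there is a compact exhaustive set of paths of degree \<open>m\<close> at that
  vertex, and a boundary path has to follow one of them, hence moves on in direction \<open>i\<close>.
\<close>

lemma periodic_boundary_path_infinite:
  assumes ns: "no_sources \<Lambda>" and ca: "compactly_aligned \<Lambda>" and W: "openin (otop \<Lambda>) W"
    and inv: "src \<Lambda> ` paths_into \<Lambda> W \<subseteq> W"
    and P: "periodic_on \<Lambda> W m n" and J: "m \<squnion>\<^sub>v n = m + n"
    and x: "x \<in> boundary_paths \<Lambda>"
    and r: "path_rng \<Lambda> x \<in> src \<Lambda> ` (paths_into \<Lambda> W \<inter> paths_of_degree \<Lambda> (m + n))"
    and i: "m $ i \<noteq> 0"
  shows "pdeg x $ i = \<infinity>"
proof (rule ccontr)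
  assume "pdeg x $ i \<noteq> \<infinity>"
  then obtain c where c: "pdeg x $ i = enat c" by auto
  \<comment> \<open>A finite degree that exhausts \<open>d(x)\<close> in direction \<open>i\<close>.\<close>
  define p :: "nat ^ 'k" where "p = (\<chi> j. if j = i then c else 0)"
  have p: "to_enat p \<le> pdeg x"
    using c by (simp add: less_eq_vec_def p_def zero_enat_def[symmetric])
  have xp: "x \<in> path_space \<Lambda>" using x by (simp add: boundary_paths_def)
  have z: "0 \<le> p" by simp
  have "src \<Lambda> (pseg x 0 p) \<in> src \<Lambda> ` (paths_into \<Lambda> W \<inter> paths_of_degree \<Lambda> (m + n))"
    using downstream_invariant[OF r inv pseg_props(1)[OF xp z p]] pseg_props(5)[OF xp z p]
    by (simp add: path_rng_def)
  then have "vertex_at \<Lambda> x p \<in> src \<Lambda> ` (paths_into \<Lambda> W \<inter> paths_of_degree \<Lambda> (m + n))"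
    using pseg_props(6)[OF xp z p] by simp
  from periodic_compact_exhaustive[OF ns ca W P J this] obtain E where
    E: "compact_exhaustive \<Lambda> (vertex_at \<Lambda> x p) E" "E \<subseteq> paths_of_degree \<Lambda> m" .
  then obtain \<rho> where "\<rho> \<in> E" "to_enat (p + deg \<Lambda> \<rho>) \<le> pdeg x"
    using x p unfolding boundary_paths_def by blast
  then have "to_enat (p + m) \<le> pdeg x" using E(2) by (auto simp: paths_of_degree_def)
  then have "to_enat (p + m) $ i \<le> pdeg x $ i" unfolding less_eq_vec_def by blast
  then show False using c i by (simp add: p_def)
qed

theorem condition_A_imp_condition_B:
  assumes ns: "no_sources \<Lambda>" and ca: "compactly_aligned \<Lambda>" and A: "condition_A \<Lambda>"
  shows "condition_B \<Lambda>"
proof (rule ccontr)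
  assume "\<not> condition_B \<Lambda>"
  from not_condition_B_imp_periodic[OF ns this] obtain W\<^sub>0 m n where
    W0: "openin (otop \<Lambda>) W\<^sub>0" "W\<^sub>0 \<noteq> {}" "m \<noteq> n" "m \<squnion>\<^sub>v n = m + n" "periodic_on \<Lambda> W\<^sub>0 m n" .
  \<comment> \<open>All vertices of a path with range in \<open>W\<close> lie in \<open>W\<close> again.\<close>
  define W where "W = src \<Lambda> ` paths_into \<Lambda> W\<^sub>0"
  have W: "openin (otop \<Lambda>) W"
    unfolding W_def using W0(1) by (intro openin_src_image openin_paths_into)
  have Wne: "W \<noteq> {}"
    unfolding W_def using downstream_nonempty[OF ns W0(1,2), of 0] by blast
  have P: "periodic_on \<Lambda> W m n"
    unfolding W_def using periodic_on_downstream[OF W0(5)] .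
  have inv: "src \<Lambda> ` paths_into \<Lambda> W \<subseteq> W"
  proof
    fix v assume "v \<in> src \<Lambda> ` paths_into \<Lambda> W"
    then obtain \<rho> where \<rho>: "\<rho> \<in> Mor \<Lambda>" "rng \<Lambda> \<rho> \<in> W" "v = src \<Lambda> \<rho>"
      by (auto simp: paths_into_def)
    then obtain \<mu> where "\<mu> \<in> paths_into \<Lambda> W\<^sub>0" "(\<mu>, \<rho>) \<in> composable \<Lambda>"
      unfolding W_def by (auto simp: paths_into_def composable_def)
    then have "cmp \<Lambda> \<mu> \<rho> \<in> paths_into \<Lambda> W\<^sub>0" "v = src \<Lambda> (cmp \<Lambda> \<mu> \<rho>)"
      using \<rho>(3) cmp_Mor rng_cmp src_cmp by (simp_all add: paths_into_def)
    then show "v \<in> W" unfolding W_def by blast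
  qed
  let ?D = "src \<Lambda> ` (paths_into \<Lambda> W \<inter> paths_of_degree \<Lambda> (m + n))"
  have "openin (otop \<Lambda>) ?D" "?D \<noteq> {}"
    using openin_downstream[OF W] downstream_nonempty[OF ns W Wne] by blast+
  then obtain x where x: "x \<in> boundary_paths \<Lambda>" "path_rng \<Lambda> x \<in> ?D" "aperiodic \<Lambda> x"
    using A unfolding condition_A_def by blast
  have xp: "x \<in> path_space \<Lambda>" using x by (simp add: boundary_paths_def)
  have xW: "path_rng \<Lambda> x \<in> W" using x(2) inv by blast
  have J': "n \<squnion>\<^sub>v m = n + m" using W0(4) vjoin_commute[of n m] by (simp add: add.commute)
  have inf: "pdeg x $ i = \<infinity>" if "m $ i \<noteq> 0 \<or> n $ i \<noteq> 0" for i
    using that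
  proof
    assume "m $ i \<noteq> 0"
    then show ?thesis
      by (rule periodic_boundary_path_infinite[OF ns ca W inv P W0(4) x(1,2)])
  next
    assume "n $ i \<noteq> 0"
    moreover have "path_rng \<Lambda> x \<in> src \<Lambda> ` (paths_into \<Lambda> W \<inter> paths_of_degree \<Lambda> (n + m))"
      using x(2) by (simp add: add.commute)
    ultimately show ?thesis
      using periodic_boundary_path_infinite[OF ns ca W inv periodic_on_sym[OF P] J' x(1)] by blast
  qed
  have zero: "m $ i = 0 \<and> n $ i = 0" if "pdeg x $ i \<noteq> \<infinity>" for i
    using inf[of i] that by argo
  have le: "to_enat m \<le> pdeg x" "to_enat n \<le> pdeg x"
  proof -
    have "enat (m $ i) \<le> pdeg x $ i" "enat (n $ i) \<le> pdeg x $ i" for i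
      using zero[of i] by (cases "pdeg x $ i = \<infinity>"; simp add: zero_enat_def[symmetric])+
    then show "to_enat m \<le> pdeg x" "to_enat n \<le> pdeg x" by (simp_all add: less_eq_vec_def)
  qed
  have "(pdeg x - to_enat m) $ i = (pdeg x - to_enat n) $ i" for i
    using zero[of i] by (cases "pdeg x $ i = \<infinity>") simp_all
  then have d: "pdeg x - to_enat m = pdeg x - to_enat n"
    by (simp add: vec_eq_iff)
  have "shift \<Lambda> m x = shift \<Lambda> n x"
  proof (rule shift_eqI[OF d])
    fix q assume "to_enat q \<le> pdeg x - to_enat m"
    then have q: "to_enat (m + q) \<le> pdeg x"
      using to_enat_le_diff[OF le(1)] by simp
    let ?t = "m + n + q"
    have "to_enat ?t $ i \<le> pdeg x $ i" for i
      using q zero[of i] unfolding less_eq_vec_def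
      by (cases "pdeg x $ i = \<infinity>") (auto dest: spec[of _ i])
    then have t: "to_enat ?t \<le> pdeg x" by (simp add: less_eq_vec_def)
    have "pseg x 0 ?t \<in> paths_into \<Lambda> W"
      using pseg_props(1,5)[OF xp _ t, of 0] xW by (simp add: paths_into_def path_rng_def)
    moreover have "deg \<Lambda> (pseg x 0 ?t) = (m \<squnion>\<^sub>v n) + q"
      using pseg_props(2)[OF xp _ t, of 0] W0(4) by simp
    ultimately have "segment \<Lambda> (pseg x 0 ?t) m (m + q) = segment \<Lambda> (pseg x 0 ?t) n (n + q)"
      using P unfolding periodic_on_def by blast
    moreover have "m + q \<le> ?t" "n + q \<le> ?t"
      by (simp_all add: less_eq_vec_def)
    ultimately show "pseg x m (m + q) = pseg x n (n + q)"
      using segment_pseg[OF xp _ _ t] by simp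
  qed
  then show False using x(3) le W0(3) unfolding aperiodic_def by blast
qed

section \<open>Condition (B) implies condition (A)\<close>


text \<open>
  The degrees in a compact set are bounded, so one segment \<open>x(p, p + q)\<close> is at least as long as every
  element of \<open>E\<close>. An element of \<open>E\<close> that has a minimal common extension with this segment is
  then an initial part of it.
\<close>

lemma infinite_path_boundary:
  assumes x: "x \<in> path_space \<Lambda>" and inf: "\<And>i. pdeg x $ i = \<infinity>"
  shows "x \<in> boundary_paths \<Lambda>"
proof -
  have le: "to_enat q \<le> pdeg x" for q
    using to_enat_le_infinite inf .
  have "\<exists>\<rho>\<in>E. to_enat (p + deg \<Lambda> \<rho>) \<le> pdeg x \<and> pseg x p (p + deg \<Lambda> \<rho>) = \<rho>"
    if E: "compact_exhaustive \<Lambda> (vertex_at \<Lambda> x p) E" for p E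
  proof -
    have "compactin (discrete_topology UNIV) (deg \<Lambda> ` E)"
      using E image_compactin continuous_deg unfolding compact_exhaustive_def by blast
    then have "finite (deg \<Lambda> ` E)" by (simp add: compactin_discrete_topology)
    from finite_vec_bounded[OF this] obtain q where
      q: "\<forall>d\<in>deg \<Lambda> ` E. d \<le> q" .
    let ?\<omega> = "pseg x p (p + q)"
    have pq: "p \<le> p + q" by simp
    have w: "?\<omega> \<in> Mor \<Lambda>" "deg \<Lambda> ?\<omega> = q" "rng \<Lambda> ?\<omega> = vertex_at \<Lambda> x p"
      using pseg_props(1,2,5)[OF x pq le] by simp_all
    then have "?\<omega> \<in> paths_into \<Lambda> (rng \<Lambda> ` E)"
      using E unfolding compact_exhaustive_def paths_into_def by auto
    then obtain \<mu> \<rho> where m: "\<mu> \<in> E" "\<rho> \<in> mce \<Lambda> ?\<omega> \<mu>"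
      using E unfolding compact_exhaustive_def by blast
    have d: "deg \<Lambda> \<mu> \<le> q" using q m(1) by blast
    obtain \<alpha> \<beta> where a: "(?\<omega>, \<alpha>) \<in> composable \<Lambda>" "(\<mu>, \<beta>) \<in> composable \<Lambda>"
        "\<rho> = cmp \<Lambda> ?\<omega> \<alpha>" "\<rho> = cmp \<Lambda> \<mu> \<beta>" "deg \<Lambda> \<rho> = q \<squnion>\<^sub>v deg \<Lambda> \<mu>"
      using m(2) w(2) unfolding mce_def by auto
    have "q + deg \<Lambda> \<alpha> = q"
      using deg_cmp[OF a(1)] a(3,5) w(2) vjoin_absorb[OF d] by simp
    then have "deg \<Lambda> \<alpha> = 0" by simp
    then have "\<alpha> = idt \<Lambda> (src \<Lambda> ?\<omega>)"
      using deg_zero_eq_idt(1) composableD(2,3)[OF a(1)] by metis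
    then have "\<rho> = ?\<omega>" using cmp_idt[OF w(1)] a(3) by simp
    moreover have "cmp \<Lambda> (pseg x p (p + deg \<Lambda> \<mu>)) (pseg x (p + deg \<Lambda> \<mu>) (p + q)) = ?\<omega>"
      "(pseg x p (p + deg \<Lambda> \<mu>), pseg x (p + deg \<Lambda> \<mu>) (p + q)) \<in> composable \<Lambda>"
      using cmp_pseg[OF x _ _ le, of p "p + deg \<Lambda> \<mu>" "p + q"] d by (simp_all add: add_left_mono)
    moreover have "deg \<Lambda> (pseg x p (p + deg \<Lambda> \<mu>)) = deg \<Lambda> \<mu>"
      using pseg_props(2)[OF x _ le, of p "p + deg \<Lambda> \<mu>"] by simp
    ultimately have "pseg x p (p + deg \<Lambda> \<mu>) = \<mu>"
      using factorization_cancel(1)[OF _ a(2)] a(4) by simp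
    then show ?thesis using m(1) le by blast
  qed
  then show ?thesis
    using x unfolding boundary_paths_def by blast
qed

lemma coherent_sequence_path:
  fixes t :: "nat \<Rightarrow> nat ^ 'k"
  assumes \<kappa>: "\<And>j. \<kappa> j \<in> Mor \<Lambda>" "\<And>j. deg \<Lambda> (\<kappa> j) = t j"
    and mono: "\<And>j. t j \<le> t (Suc j)"
    and coh: "\<And>j. segment \<Lambda> (\<kappa> (Suc j)) 0 (t j) = \<kappa> j"
    and cofinal: "\<And>q. \<exists>j. q \<le> t j"
  obtains x where "x \<in> path_space \<Lambda>" "\<forall>i. pdeg x $ i = \<infinity>"
    "\<forall>j p q. p \<le> q \<longrightarrow> q \<le> t j \<longrightarrow> pseg x p q = segment \<Lambda> (\<kappa> j) p q"
proof -
  have mono': "t j \<le> t l" if "j \<le> l" for j l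
    using lift_Suc_mono_le[of t j l] mono that by blast
  have step: "segment \<Lambda> (\<kappa> l) p q = segment \<Lambda> (\<kappa> j) p q" if "j \<le> l" "p \<le> q" "q \<le> t j" for j l p q
    using that
  proof (induction l rule: dec_induct)
    case base
    show ?case ..
  next
    case (step l)
    have "q \<le> t l" using mono'[OF step.hyps(1)] step.prems by simp
    then have "segment \<Lambda> (segment \<Lambda> (\<kappa> (Suc l)) 0 (t l)) p q = segment \<Lambda> (\<kappa> (Suc l)) p q"
      using step.prems mono[of l] \<kappa> by (intro segment_segment_prefix) simp_all
    then show ?case using coh step by simp
  qed
  have indep: "segment \<Lambda> (\<kappa> l) p q = segment \<Lambda> (\<kappa> j) p q" if "p \<le> q" "q \<le> t j" "q \<le> t l" for j l p q
    using step[of j l p q] step[of l j p q] that by (cases "j \<le> l") simp_all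
  define D :: "enat ^ 'k" where "D = (\<chi> i. \<infinity>)"
  have D: "to_enat q \<le> D" for q
    by (rule to_enat_le_infinite) (simp add: D_def)
  define f where "f = restrict (\<lambda>(p, q). segment \<Lambda> (\<kappa> (LEAST j. q \<le> t j)) p q) (Mor (Omega D))"
  have f: "f (p, q) = segment \<Lambda> (\<kappa> j) p q" if "p \<le> q" "q \<le> t j" for p q j
  proof -
    have "f (p, q) = segment \<Lambda> (\<kappa> (LEAST j. q \<le> t j)) p q"
      using that(1) D by (simp add: f_def)
    also have "\<dots> = segment \<Lambda> (\<kappa> j) p q"
      by (rule indep[OF that]) (rule LeastI[of "\<lambda>j. q \<le> t j", OF that(2)])
    finally show ?thesis .
  qed
  have "continuous_degree_functor (Omega D) \<Lambda> f"
    unfolding continuous_degree_functor_Omega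
  proof (intro conjI allI impI; elim conjE)
    fix p q :: "nat ^ 'k" assume pq: "p \<le> q"
    obtain j where j: "q \<le> t j" using cofinal by blast
    have pj: "p \<le> t j" using pq j by simp
    have qd: "q \<le> deg \<Lambda> (\<kappa> j)" using j \<kappa>(2) by simp
    have F: "f (p, q) = segment \<Lambda> (\<kappa> j) p q" "f (p, p) = segment \<Lambda> (\<kappa> j) p p"
        "f (q, q) = segment \<Lambda> (\<kappa> j) q q"
      using f pq j pj by simp_all
    show "f (p, q) \<in> Mor \<Lambda>" "f (p, p) = idt \<Lambda> (rng \<Lambda> (f (p, q)))"
      "f (q, q) = idt \<Lambda> (src \<Lambda> (f (p, q)))" "deg \<Lambda> (f (p, q)) = q - p"
      unfolding F using segment_Mor segment_refl deg_segment \<kappa>(1) pq qd by blast+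
  next
    fix p q s :: "nat ^ 'k" assume pqs: "p \<le> q" "q \<le> s"
    obtain j where j: "s \<le> t j" using cofinal by blast
    have F: "f (p, s) = segment \<Lambda> (\<kappa> j) p s" "f (p, q) = segment \<Lambda> (\<kappa> j) p q"
        "f (q, s) = segment \<Lambda> (\<kappa> j) q s"
      using f pqs j by simp_all
    show "f (p, s) = cmp \<Lambda> (f (p, q)) (f (q, s))"
      unfolding F using cmp_segment(2)[OF \<kappa>(1) pqs] j \<kappa>(2) by simp
  qed
  moreover have "f \<in> extensional (Mor (Omega D))" by (simp add: f_def)
  ultimately have "(D, f) \<in> path_space \<Lambda>" by (simp add: path_space_def)
  then show ?thesis
    using that[of "(D, f)"] f by (simp add: D_def)
qed

lemma nested_compact_limit:
  assumes N: "\<And>j. compactin (mtop \<Lambda>) (N j)" "\<And>j. N j \<noteq> {}" "\<And>j. N j \<subseteq> paths_of_degree \<Lambda> (t j)"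
    and t: "\<And>j. t j \<le> t (Suc j)"
    and nest: "\<And>j \<rho>. \<rho> \<in> N (Suc j) \<Longrightarrow> segment \<Lambda> \<rho> 0 (t j) \<in> N j"
  obtains \<kappa> where "\<forall>j. \<kappa> j \<in> N j" "\<forall>j. segment \<Lambda> (\<kappa> (Suc j)) 0 (t j) = \<kappa> j"
proof -
  have ts: "topspace (subtopology (mtop \<Lambda>) (N j)) = N j" for j
    using compactin_subset_topspace[OF N(1)] by auto
  have "continuous_map (subtopology (mtop \<Lambda>) (N (Suc j))) (subtopology (mtop \<Lambda>) (N j)) (\<lambda>\<rho>. segment \<Lambda> \<rho> 0 (t j))" for j
  proof -
    have "continuous_map (subtopology (mtop \<Lambda>) (N (Suc j))) (mtop \<Lambda>) (\<lambda>\<rho>. segment \<Lambda> \<rho> 0 (t j))"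
      using continuous_map_from_subtopology_mono[OF continuous_segment N(3)] t by simp
    then show ?thesis
      using nest ts by (auto simp: continuous_map_in_subtopology)
  qed
  moreover have "compact_space (subtopology (mtop \<Lambda>) (N j))" "Hausdorff_space (subtopology (mtop \<Lambda>) (N j))" for j
    using N(1) Hausdorff_mtop Hausdorff_space_subtopology by (auto simp: compact_space_subtopology)
  ultimately show ?thesis
    using inverse_limit_nonempty[of "\<lambda>j. subtopology (mtop \<Lambda>) (N j)" "\<lambda>j \<rho>. segment \<Lambda> \<rho> 0 (t j)"]
      ts N(2) that by (metis (no_types, lifting))
qed

text \<open>
  The sets in the nested sequence. The interior leaves room for the next refinement, and compactness
  provides a point of the limit.
\<close>

definition compact_patch :: "nat ^ 'k \<Rightarrow> 'a set \<Rightarrow> bool" where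
  "compact_patch t N \<longleftrightarrow> compactin (mtop \<Lambda>) N \<and> N \<subseteq> paths_of_degree \<Lambda> t \<and>
     (\<exists>U. openin (mtop \<Lambda>) U \<and> U \<noteq> {} \<and> U \<subseteq> N)"

lemma compact_patch_in_open:
  assumes "openin (mtop \<Lambda>) U" "U \<noteq> {}" "U \<subseteq> paths_of_degree \<Lambda> t"
  obtains N where "compact_patch t N" "N \<subseteq> U"
proof -
  obtain \<rho> where "\<rho> \<in> U" using assms(2) by blast
  from compact_neighbourhood[OF locally_compact_mtop Hausdorff_mtop assms(1) this] obtain V K where
    "openin (mtop \<Lambda>) V" "compactin (mtop \<Lambda>) K" "\<rho> \<in> V" "V \<subseteq> K" "K \<subseteq> U" .
  note K = this
  then have "compact_patch t K"
    using assms(3) unfolding compact_patch_def by blast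
  then show ?thesis using K(5) by (rule that)
qed

text \<open>
  Apply (B) to the open set \<open>s(U)\<close>, where \<open>U\<close> is open in \<open>N\<close>, and prefix the resulting path by an element
  of \<open>U\<close>. Both requirements on \<open>N'\<close> are open conditions that this longer path satisfies. The segments
  are compared only after the first \<open>t\<close> steps, as (B) is applied there; this suffices, since
  \<open>\<sigma>\<^bsup>t + m\<^esup> x \<noteq> \<sigma>\<^bsup>t + n\<^esup> x\<close> implies \<open>\<sigma>\<^sup>m x \<noteq> \<sigma>\<^sup>n x\<close>.
\<close>

lemma compact_patch_refine:
  assumes B: "condition_B \<Lambda>" and N: "compact_patch t N" and mn: "m \<noteq> n"
  obtains q N' where "compact_patch (t + (m \<squnion>\<^sub>v n) + q) N'" "\<forall>\<rho>\<in>N'. segment \<Lambda> \<rho> 0 t \<in> N"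
    "\<forall>\<rho>\<in>N'. segment \<Lambda> \<rho> (t + m) (t + m + q) \<noteq> segment \<Lambda> \<rho> (t + n) (t + n + q)"
proof -
  obtain U where U: "openin (mtop \<Lambda>) U" "U \<noteq> {}" "U \<subseteq> N" and Nt: "N \<subseteq> paths_of_degree \<Lambda> t"
    using N unfolding compact_patch_def by blast
  have "\<not> periodic_on \<Lambda> (src \<Lambda> ` U) m n"
    using B U(2) mn openin_src_image[OF U(1)] unfolding condition_B_iff by blast
  then obtain \<rho> q where r: "\<rho> \<in> paths_into \<Lambda> (src \<Lambda> ` U)" "deg \<Lambda> \<rho> = (m \<squnion>\<^sub>v n) + q"
      "segment \<Lambda> \<rho> m (m + q) \<noteq> segment \<Lambda> \<rho> n (n + q)"
    unfolding periodic_on_def by blast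
  let ?T = "t + (m \<squnion>\<^sub>v n) + q"
  obtain \<mu> where m: "\<mu> \<in> U" "(\<mu>, \<rho>) \<in> composable \<Lambda>" "deg \<Lambda> \<mu> = t"
    using r(1) U(3) Nt by (auto simp: paths_into_def composable_def paths_of_degree_def)
  have le: "m + q \<le> (m \<squnion>\<^sub>v n) + q" "n + q \<le> (m \<squnion>\<^sub>v n) + q"
    using vjoin_upper by (auto intro: add_right_mono)
  have le': "t \<le> ?T" "t + m + q \<le> ?T" "t + n + q \<le> ?T"
    using add_left_mono[OF le(1), of t] add_left_mono[OF le(2), of t] by (simp_all add: add.assoc)
  define O' where "O' = {\<rho> \<in> paths_of_degree \<Lambda> ?T. segment \<Lambda> \<rho> 0 t \<in> U} \<inter>
    {\<rho> \<in> paths_of_degree \<Lambda> ?T. segment \<Lambda> \<rho> (t + m) (t + m + q) \<noteq> segment \<Lambda> \<rho> (t + n) (t + n + q)}"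
  have O1: "openin (mtop \<Lambda>) O'"
    unfolding O'_def using U(1) le' by (intro openin_Int openin_segment_preimage openin_segments_differ) simp_all
  have "cmp \<Lambda> \<mu> \<rho> \<in> O'"
  proof -
    have "cmp \<Lambda> \<mu> \<rho> \<in> paths_of_degree \<Lambda> ?T"
      using cmp_Mor[OF m(2)] deg_cmp[OF m(2)] m(3) r(2) by (simp add: paths_of_degree_def add.assoc)
    moreover have "segment \<Lambda> (cmp \<Lambda> \<mu> \<rho>) 0 t = \<mu>"
      using segment_prefix[OF m(2)] m(3) by simp
    moreover have "segment \<Lambda> (cmp \<Lambda> \<mu> \<rho>) (t + m) (t + m + q) = segment \<Lambda> \<rho> m (m + q)"
      "segment \<Lambda> (cmp \<Lambda> \<mu> \<rho>) (t + n) (t + n + q) = segment \<Lambda> \<rho> n (n + q)"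
      using segment_cmp_right[OF m(2), of m "m + q"] segment_cmp_right[OF m(2), of n "n + q"] le r(2) m(3)
      by (simp_all add: add.assoc)
    ultimately show ?thesis unfolding O'_def using m(1) r(3) by simp
  qed
  then have "O' \<noteq> {}" by blast
  moreover have "O' \<subseteq> paths_of_degree \<Lambda> ?T" unfolding O'_def by blast
  ultimately obtain N' where N': "compact_patch ?T N'" "N' \<subseteq> O'"
    using compact_patch_in_open[OF O1] by blast
  show ?thesis
  proof (rule that[OF N'(1)]; rule ballI)
    fix \<rho> assume "\<rho> \<in> N'"
    then have "\<rho> \<in> O'" using N'(2) by blast
    then show "segment \<Lambda> \<rho> 0 t \<in> N"
      "segment \<Lambda> \<rho> (t + m) (t + m + q) \<noteq> segment \<Lambda> \<rho> (t + n) (t + n + q)"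
      unfolding O'_def using U(3) by blast+
  qed
qed

theorem condition_B_imp_condition_A:
  assumes ns: "no_sources \<Lambda>" and B: "condition_B \<Lambda>"
  shows "condition_A \<Lambda>"
  unfolding condition_A_def
proof (intro allI impI; elim conjE)
  fix V assume V: "openin (otop \<Lambda>) V" "V \<noteq> {}"
  have U0: "openin (mtop \<Lambda>) (paths_into \<Lambda> V \<inter> paths_of_degree \<Lambda> 0)"
    using V by (intro openin_Int openin_paths_into openin_paths_of_degree)
  have "paths_into \<Lambda> V \<inter> paths_of_degree \<Lambda> 0 \<noteq> {}"
    using downstream_nonempty[OF ns V, of 0] by blast
  from compact_patch_in_open[OF U0 this Int_lower2] obtain N0 where
    N0: "compact_patch 0 N0" "N0 \<subseteq> paths_into \<Lambda> V \<inter> paths_of_degree \<Lambda> 0" .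
  define e :: "nat \<Rightarrow> (nat ^ 'k) \<times> (nat ^ 'k)" where "e = from_nat"
  have e: "\<exists>k. e k = z" for z
    using surj_from_nat unfolding e_def surj_def by metis
  define R where "R k S S' \<longleftrightarrow> (\<forall>\<rho>\<in>snd S'. segment \<Lambda> \<rho> 0 (fst S) \<in> snd S) \<and> fst S \<le> fst S' \<and>
      (\<forall>m n. e k = (m, n) \<and> m \<noteq> n \<longrightarrow> (\<exists>q. fst S' = fst S + (m \<squnion>\<^sub>v n) + q \<and>
        (\<forall>\<rho>\<in>snd S'. segment \<Lambda> \<rho> (fst S + m) (fst S + m + q) \<noteq> segment \<Lambda> \<rho> (fst S + n) (fst S + n + q))))"
    for k S S'
  have "\<exists>S. \<forall>k. (compact_patch (fst (S k)) (snd (S k)) \<and> (k = 0 \<longrightarrow> snd (S k) \<subseteq> paths_into \<Lambda> V)) \<and> R k (S k) (S (Suc k))"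
  proof (rule dependent_nat_choice)
    show "\<exists>S. compact_patch (fst S) (snd S) \<and> (0 = (0::nat) \<longrightarrow> snd S \<subseteq> paths_into \<Lambda> V)"
      using N0 by (intro exI[of _ "(0, N0)"]) simp
  next
    fix S k assume S: "compact_patch (fst S) (snd S) \<and> (k = (0::nat) \<longrightarrow> snd S \<subseteq> paths_into \<Lambda> V)"
    obtain t N where S': "S = (t, N)" by (cases S)
    obtain m n where mn: "e k = (m, n)" by (cases "e k")
    show "\<exists>S'. (compact_patch (fst S') (snd S') \<and> (Suc k = 0 \<longrightarrow> snd S' \<subseteq> paths_into \<Lambda> V)) \<and> R k S S'"
    \<comment> \<open>There is nothing to separate for \<open>m = n\<close>, and the set is kept.\<close>
    proof (cases "m = n")
      case True
      have "segment \<Lambda> \<rho> 0 t = \<rho>" if "\<rho> \<in> N" for \<rho>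
        using S S' that segment_full by (auto simp: compact_patch_def paths_of_degree_def)
      then have "R k S S" unfolding R_def S' using mn True by simp
      then show ?thesis using S by blast
    next
      case False
      have "compact_patch t N" using S S' by simp
      from compact_patch_refine[OF B this False] obtain q N' where
        "compact_patch (t + (m \<squnion>\<^sub>v n) + q) N'" "\<forall>\<rho>\<in>N'. segment \<Lambda> \<rho> 0 t \<in> N"
        "\<forall>\<rho>\<in>N'. segment \<Lambda> \<rho> (t + m) (t + m + q) \<noteq> segment \<Lambda> \<rho> (t + n) (t + n + q)" .
      then show ?thesis
        unfolding R_def S' using mn
        by (intro exI[of _ "(t + (m \<squnion>\<^sub>v n) + q, N')"]) (auto simp: add.assoc)
    qed
  qed
  then obtain S where S: "\<And>k. compact_patch (fst (S k)) (snd (S k))" "snd (S 0) \<subseteq> paths_into \<Lambda> V"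
    "\<And>k. R k (S k) (S (Suc k))" by blast
  define t N where "t k = fst (S k)" and "N k = snd (S k)" for k
  have N: "compactin (mtop \<Lambda>) (N k)" "N k \<noteq> {}" "N k \<subseteq> paths_of_degree \<Lambda> (t k)" for k
    using S(1)[of k] unfolding compact_patch_def t_def N_def by auto
  have tmono: "t k \<le> t (Suc k)" and nest: "\<rho> \<in> N (Suc k) \<Longrightarrow> segment \<Lambda> \<rho> 0 (t k) \<in> N k" for k \<rho>
    using S(3)[of k] unfolding R_def t_def N_def by blast+
  have sep: "\<exists>q. t (Suc k) = t k + (m \<squnion>\<^sub>v n) + q \<and>
      (\<forall>\<rho>\<in>N (Suc k). segment \<Lambda> \<rho> (t k + m) (t k + m + q) \<noteq> segment \<Lambda> \<rho> (t k + n) (t k + n + q))"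
    if "e k = (m, n)" "m \<noteq> n" for k m n
    using S(3)[of k] that unfolding R_def t_def N_def by blast
  from nested_compact_limit[of N t, OF N tmono nest] obtain \<kappa> where
    k: "\<forall>j. \<kappa> j \<in> N j" "\<forall>j. segment \<Lambda> (\<kappa> (Suc j)) 0 (t j) = \<kappa> j" .
  have kM: "\<kappa> j \<in> Mor \<Lambda>" "deg \<Lambda> (\<kappa> j) = t j" for j
    using k(1)[rule_format, of j] N(3)[of j] by (auto simp: paths_of_degree_def)
  have cofinal: "\<exists>j. q \<le> t j" for q
  proof -
    \<comment> \<open>Separating a pair \<open>(m, n)\<close> lengthens the paths by at least \<open>m \<or> n\<close>.\<close>
    obtain j where j: "e j = (q, q + 1)" using e by blast
    have "q \<noteq> q + 1" by (simp add: vec_eq_iff)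
    from sep[OF j this] obtain r where "t (Suc j) = t j + (q \<squnion>\<^sub>v (q + 1)) + r" by blast
    then have "q \<le> t (Suc j)"
      by (auto simp: less_eq_vec_def)
    then show ?thesis ..
  qed
  from coherent_sequence_path[OF kM tmono k(2)[rule_format] cofinal] obtain x where
    x: "x \<in> path_space \<Lambda>" and inf: "\<forall>i. pdeg x $ i = \<infinity>"
      and seg: "\<forall>j p q. p \<le> q \<longrightarrow> q \<le> t j \<longrightarrow> pseg x p q = segment \<Lambda> (\<kappa> j) p q" .
  have le: "to_enat q \<le> pdeg x" for q by (rule to_enat_le_infinite) (use inf in blast)
  have "x \<in> boundary_paths \<Lambda>" using infinite_path_boundary[OF x] inf by blast
  moreover have "path_rng \<Lambda> x \<in> V"
  proof -
    have "path_rng \<Lambda> x = rng \<Lambda> (pseg x 0 (t 0))"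
      unfolding path_rng_def using pseg_props(5)[OF x _ le, of 0 "t 0"] by simp
    also have "pseg x 0 (t 0) = \<kappa> 0"
      using seg[rule_format, of 0 "t 0" 0] segment_full[OF kM(1)[of 0]] kM(2)[of 0] by simp
    finally show ?thesis
      using k(1)[rule_format, of 0] S(2) by (auto simp: N_def paths_into_def)
  qed
  moreover have "aperiodic \<Lambda> x"
    unfolding aperiodic_def
  proof (intro allI impI; elim conjE)
    fix m n assume eq: "shift \<Lambda> m x = shift \<Lambda> n x"
    show "m = n"
    proof (rule ccontr)
      assume "m \<noteq> n"
      obtain j where j: "e j = (m, n)" using e by blast
      from sep[OF j \<open>m \<noteq> n\<close>] obtain q where q: "t (Suc j) = t j + (m \<squnion>\<^sub>v n) + q"
        "segment \<Lambda> (\<kappa> (Suc j)) (t j + m) (t j + m + q) \<noteq> segment \<Lambda> (\<kappa> (Suc j)) (t j + n) (t j + n + q)"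
        using k(1) by blast
      have "t j + m + q \<le> t (Suc j)" "t j + n + q \<le> t (Suc j)"
        unfolding q(1) by (simp_all add: less_eq_vec_def)
      then show False
        using q(2) seg shift_eqD[OF x inf[rule_format] eq, of "t j" q] by simp
    qed
  qed
  ultimately show "\<exists>x\<in>boundary_paths \<Lambda>. path_rng \<Lambda> x \<in> V \<and> aperiodic \<Lambda> x" by blast
qed

end


section \<open>The equivalence of the three conditions\<close>


theorem theorem3p1:
  fixes \<Lambda> :: "('v, 'a, 'k::finite) kgraph"
  assumes "topological_kgraph \<Lambda>"
    and "compactly_aligned \<Lambda>"
    and "no_sources \<Lambda>"
  shows "(condition_A \<Lambda> \<longleftrightarrow> condition_B \<Lambda>) \<and> (condition_B \<Lambda> \<longleftrightarrow> condition_C \<Lambda>)"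
proof -
  interpret topological_kgraph \<Lambda> by (fact assms(1))
  show ?thesis
    using condition_A_imp_condition_B condition_B_imp_condition_A
      condition_B_imp_condition_C condition_C_imp_condition_B assms(2,3) by blast
qed

end
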